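(* Let $K=f(S^1)\subset\mathbb{R}^3$ be a knot. Then the real part of the infinitesimal cross-ratio $\Omega_{CR}$ is equal to minus one half of the pull-back of the canonical symplectic form $\omega_0$ of the cotangent bundle $T^*S^3$: as 2-forms on $K\times K\setminus\triangle$, $$\cos\theta\,\frac{dx\,dy}{|x-y|^2}=\Re\,\Omega_{CR}=-\frac12\,\omega_{\mathbb{R}^3}\big|_{K\times K\setminus\triangle}=-\frac12(\iota_K\times\iota_K)^*P_3^*\psi_3^*\omega_0,$$ where $\iota_K:K\to\mathbb{R}^3$ is the inclusion map.
   Context: A knot $K=f(S^1)$ is the image of an embedding $f:S^1\to\mathbb{R}^3$ of class $C^2$, parametrized by arc-length; $dx\,dy$ denotes $ds\wedge dt$ for $x=f(s),y=f(t)$, and $\triangle$ is the diagonal. Conformal angle: for distinct $x,y\in K$, let $C(x,x,y)$ be the circle (possibly a line) tangent to $K$ at $x$ through $y$, oriented by $K$ at $x$, and similarly $C(y,y,x)$; $\theta=\theta_K(x,y)$ is the angle between $C(x,x,y)$ and $C(y,y,x)$ at $x$ or at $y$ (its sign is irrelevant here). Infinitesimal cross-ratio: for $(x_0,y_0)\in K\times K\setminus\triangle$ let $\Sigma_K(x_0,y_0)$ be the oriented twice tangent sphere, i.e. the oriented 2-sphere tangent to $K$ at $x_0$ and $y_0$ (if $C(x_0,x_0,y_0)$ is tangent to $K$ at $y_0$, any oriented 2-sphere containing this circle). Let $T_0$ be a conformal transformation of $\mathbb{R}^3\cup\{\infty\}$ mapping $\Sigma_K(x_0,y_0)$ to $\mathbb{R}^2\times\{0\}$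 preserving orientations. Consider the complex-valued 2-form $\frac{dw\wedge dz}{(w-z)^2}$ in the coordinates $((w,x_3),(z,y_3))\in(\mathbb{C}\times\mathbb{R})\times(\mathbb{C}\times\mathbb{R})\cong\mathbb{R}^3\times\mathbb{R}^3$. Then $\Omega_{CR}(x_0,y_0)$ is the value at $(x_0,y_0)$ of $(T_0\times T_0)^*\left(\frac{dw\wedge dz}{(w-z)^2}\right)$, restricted to $K\times K\setminus\triangle$. It has absolute value $\frac{|dx||dy|}{|x-y|^2}$ and argument $\theta$ (up to sign). Symplectic form: on $T^*M$ with local coordinates $(p_i)$ on $M$ and fibre coordinates $(q_i)$ given by $v^*=\sum q_i\,dp_i$, the canonical symplectic form is $\omega_0=\sum dp_i\wedge dq_i$. The bijection $\psi_n:S^n\times S^n\setminus\triangle\to T^*S^n$ is $\psi_n(x,y)=(x,\psi_x(y))$, where $\psi_x(y)\in T_x^*S^n$ is the covector dual, under the Euclidean inner product on $T_xS^n\cong x^\perp$, to the stereographic projection $p_x(y)=\frac{y-(x\cdot y)x}{1-x\cdot y}$ of $y$ from $x$ to $x^\perp$. With $p:S^n\setminus\{(0,\dots,0,1)\}\to\mathbb{R}^n$ the stereographic projection, $P_n=p^{-1}\times p^{-1}:\mathbb{R}^n\times\mathbb{R}^n\setminus\triangle\to S^n\times S^n\setminus\triangle$, and $\omega_{\mathbb{R}^n}=P_n^*\psi_n^*\omega_0$. *)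

theory Defs
  imports "HOL-Analysis.Analysis"
begin

section \<open>Differential 2-forms\<close>

text \<open>A 2-form on a submanifold of a normed space is represented by its values
  (point, first tangent vector, second tangent vector); only the values on tangent vectors of
  the submanifold are meaningful.\<close>

type_synonym ('a, 'b) form2 = "'a \<Rightarrow> 'a \<Rightarrow> 'a \<Rightarrow> 'b"

definition pullback ::
    "('a::real_normed_vector \<Rightarrow> 'c::real_normed_vector) \<Rightarrow> ('c, 'b) form2 \<Rightarrow> ('a, 'b) form2" where
  "pullback g \<omega> = (\<lambda>p u v. \<omega> (g p) (frechet_derivative g (at p) u) (frechet_derivative g (at p) v))"

text \<open>The form \<open>ds \<and> dt\<close> on the parameter plane of pairs \<open>(s, t)\<close>.\<close>

definition ds_dt :: "(real \<times> real, real) form2" where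
  "ds_dt = (\<lambda>p u v. fst u * snd v - fst v * snd u)"

definition C2_on ::
    "('a::real_normed_vector \<Rightarrow> 'b::real_normed_vector) \<Rightarrow> 'a set \<Rightarrow> bool" where
  "C2_on g V \<longleftrightarrow>
    (\<exists>(g' :: 'a \<Rightarrow> 'a \<Rightarrow>\<^sub>L 'b) (g'' :: 'a \<Rightarrow> 'a \<Rightarrow>\<^sub>L ('a \<Rightarrow>\<^sub>L 'b)).
       (\<forall>x\<in>V. (g has_derivative blinfun_apply (g' x)) (at x)) \<and>
       (\<forall>x\<in>V. (g' has_derivative blinfun_apply (g'' x)) (at x)) \<and>
       continuous_on V g'')"


section \<open>Knots and the conformal angle\<close>

text \<open>The circle of length \<open>L\<close> is the quotient of the real line by \<open>L\<int>\<close>, so a knot is an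
  \<open>L\<close>-periodic arc-length parametrization that is injective on a period.\<close>

definition knot :: "real \<Rightarrow> (real \<Rightarrow> real ^ 3) \<Rightarrow> bool" where
  "knot L f \<longleftrightarrow>
     L > 0 \<and> (\<forall>s. f (s + L) = f s) \<and> inj_on f {0..<L} \<and> C2_on f UNIV \<and>
     (\<forall>s. norm (vector_derivative f (at s)) = 1)"

text \<open>The map from pairs of parameters to \<open>K \<times> K\<close>. Pulling a form on \<open>\<real>\<^sup>3 \<times> \<real>\<^sup>3\<close> back
  along it restricts the form to \<open>K \<times> K\<close> and writes it in the arc-length coordinates
  \<open>(s, t)\<close>, in which tangent vectors of \<open>K \<times> K\<close> are arbitrary pairs of reals.\<close>

definition knot_pair :: "(real \<Rightarrow> real ^ 3) \<Rightarrow> real \<times> real \<Rightarrow> (real ^ 3) \<times> (real ^ 3)" where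
  "knot_pair f = map_prod f f"

text \<open>Oriented circles and lines are given by parametrizations of constant nonzero speed.\<close>

definition oriented_circle :: "(real \<Rightarrow> real ^ 3) \<Rightarrow> bool" where
  "oriented_circle \<gamma> \<longleftrightarrow>
     (\<exists>c r a b. r > 0 \<and> norm a = 1 \<and> norm b = 1 \<and> a \<bullet> b = 0 \<and>
        \<gamma> = (\<lambda>\<tau>. c + (r * cos \<tau>) *\<^sub>R a + (r * sin \<tau>) *\<^sub>R b)) \<or>
     (\<exists>c a. norm a = 1 \<and> \<gamma> = (\<lambda>\<tau>. c + \<tau> *\<^sub>R a))"

text \<open>\<open>\<gamma>\<close> parametrizes the oriented circle through \<open>y\<close> that is tangent at \<open>x\<close> to the
  direction \<open>u\<close>; with \<open>u\<close> the unit tangent of \<open>K\<close> at \<open>x\<close> this is \<open>C(x,x,y)\<close>.\<close>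

definition tangent_circle ::
    "real ^ 3 \<Rightarrow> real ^ 3 \<Rightarrow> real ^ 3 \<Rightarrow> (real \<Rightarrow> real ^ 3) \<Rightarrow> bool" where
  "tangent_circle x u y \<gamma> \<longleftrightarrow>
     oriented_circle \<gamma> \<and> y \<in> range \<gamma> \<and>
     (\<exists>\<tau> k. k > 0 \<and> \<gamma> \<tau> = x \<and> (\<gamma> has_vector_derivative k *\<^sub>R u) (at \<tau>))"

definition vector_angle :: "real ^ 3 \<Rightarrow> real ^ 3 \<Rightarrow> real" where
  "vector_angle u v = arccos (u \<bullet> v / (norm u * norm v))"

definition angle_of_curves_at ::
    "(real \<Rightarrow> real ^ 3) \<Rightarrow> (real \<Rightarrow> real ^ 3) \<Rightarrow> real ^ 3 \<Rightarrow> real \<Rightarrow> bool" where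
  "angle_of_curves_at \<gamma> \<delta> z \<theta> \<longleftrightarrow>
     (\<exists>\<sigma> \<tau>. \<gamma> \<sigma> = z \<and> \<delta> \<tau> = z \<and>
        \<theta> = vector_angle (vector_derivative \<gamma> (at \<sigma>)) (vector_derivative \<delta> (at \<tau>)))"

text \<open>The angles at the two intersection points agree, so the description is unambiguous.\<close>

definition conformal_angle :: "(real \<Rightarrow> real ^ 3) \<Rightarrow> real \<Rightarrow> real \<Rightarrow> real" where
  "conformal_angle f s t =
     (THE \<theta>. \<exists>\<gamma> \<delta>.
        tangent_circle (f s) (vector_derivative f (at s)) (f t) \<gamma> \<and>
        tangent_circle (f t) (vector_derivative f (at t)) (f s) \<delta> \<and>
        (angle_of_curves_at \<gamma> \<delta> (f s) \<theta> \<or> angle_of_curves_at \<gamma> \<delta> (f t) \<theta>))"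


section \<open>Conformal transformations and oriented spheres\<close>

text \<open>The space \<open>\<real>\<^sup>3 \<union> {\<infinity>}\<close> is modelled by the option type, with \<open>None\<close> as \<open>\<infinity>\<close>.
  By Liouville's theorem its conformal transformations are the compositions of inversions in
  spheres and reflections in planes.\<close>

definition inversion :: "real ^ 3 \<Rightarrow> real \<Rightarrow> (real ^ 3) option \<Rightarrow> (real ^ 3) option" where
  "inversion c r p =
     (case p of
        None \<Rightarrow> Some c
      | Some x \<Rightarrow>
          if x = c then None else Some (c + (r\<^sup>2 / (norm (x - c))\<^sup>2) *\<^sub>R (x - c)))"

definition plane_reflection :: "real ^ 3 \<Rightarrow> real \<Rightarrow> (real ^ 3) option \<Rightarrow> (real ^ 3) option" where
  "plane_reflection n d p = map_option (\<lambda>x. x - (2 * (n \<bullet> x - d) / (n \<bullet> n)) *\<^sub>R n) p"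

inductive conformal_transformation :: "((real ^ 3) option \<Rightarrow> (real ^ 3) option) \<Rightarrow> bool" where
  identity: "conformal_transformation id"
| inversion: "conformal_transformation T \<Longrightarrow> r > 0 \<Longrightarrow> conformal_transformation (inversion c r \<circ> T)"
| reflection:
    "conformal_transformation T \<Longrightarrow> n \<noteq> 0 \<Longrightarrow> conformal_transformation (plane_reflection n d \<circ> T)"

text \<open>The map of \<open>\<real>\<^sup>3\<close> given by \<open>T\<close>, meaningful where \<open>T\<close> does not take the value \<open>\<infinity>\<close>.\<close>

definition finite_part :: "((real ^ 3) option \<Rightarrow> (real ^ 3) option) \<Rightarrow> real ^ 3 \<Rightarrow> real ^ 3" where
  "finite_part T x = the (T (Some x))"

text \<open>Oriented 2-spheres in \<open>\<real>\<^sup>3 \<union> {\<infinity>}\<close>, including planes. An orientation is encoded by a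
  normal field: a tangent basis \<open>(a, b)\<close> is positive iff \<open>normal \<bullet> (a \<times> b) > 0\<close>.
  The radius in \<open>Round c r\<close> is signed, its sign telling the outward from the inward normal;
  \<open>Plane n d\<close> is the plane \<open>n \<bullet> x = d\<close> with normal \<open>n\<close>.\<close>

datatype oriented_sphere = Round "real ^ 3" real | Plane "real ^ 3" real

fun valid_sphere :: "oriented_sphere \<Rightarrow> bool" where
  "valid_sphere (Round c r) \<longleftrightarrow> r \<noteq> 0"
| "valid_sphere (Plane n d) \<longleftrightarrow> n \<noteq> 0"

fun sphere_points :: "oriented_sphere \<Rightarrow> (real ^ 3) option set" where
  "sphere_points (Round c r) = Some ` sphere c \<bar>r\<bar>"
| "sphere_points (Plane n d) = insert None (Some ` {x. n \<bullet> x = d})"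

fun sphere_normal :: "oriented_sphere \<Rightarrow> real ^ 3 \<Rightarrow> real ^ 3" where
  "sphere_normal (Round c r) x = (1 / r) *\<^sub>R (x - c)"
| "sphere_normal (Plane n d) x = n"

definition positive_basis_at :: "oriented_sphere \<Rightarrow> real ^ 3 \<Rightarrow> real ^ 3 \<Rightarrow> real ^ 3 \<Rightarrow> bool" where
  "positive_basis_at S x a b \<longleftrightarrow>
     sphere_normal S x \<bullet> a = 0 \<and> sphere_normal S x \<bullet> b = 0 \<and> sphere_normal S x \<bullet> cross3 a b > 0"

definition maps_oriented_sphere ::
    "((real ^ 3) option \<Rightarrow> (real ^ 3) option) \<Rightarrow> oriented_sphere \<Rightarrow> oriented_sphere \<Rightarrow> bool" where
  "maps_oriented_sphere T S S' \<longleftrightarrow>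
     T ` sphere_points S = sphere_points S' \<and>
     (\<forall>x a b. Some x \<in> sphere_points S \<longrightarrow> T (Some x) \<noteq> None \<longrightarrow> positive_basis_at S x a b \<longrightarrow>
        positive_basis_at S' (finite_part T x)
          (frechet_derivative (finite_part T) (at x) a)
          (frechet_derivative (finite_part T) (at x) b))"

text \<open>\<open>\<real>\<^sup>2 \<times> {0}\<close> with the standard orientation.\<close>

definition horizontal_plane :: oriented_sphere where
  "horizontal_plane = Plane (axis 3 1) 0"


section \<open>The infinitesimal cross-ratio\<close>

text \<open>If \<open>C(x,x,y)\<close> is tangent to \<open>K\<close> at \<open>y\<close>, the spheres tangent to \<open>K\<close> at \<open>x\<close> and \<open>y\<close> are
  exactly the spheres containing that circle, so this covers the degenerate case as well.\<close>

definition twice_tangent_sphere ::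
    "(real \<Rightarrow> real ^ 3) \<Rightarrow> real \<Rightarrow> real \<Rightarrow> oriented_sphere \<Rightarrow> bool" where
  "twice_tangent_sphere f s t S \<longleftrightarrow>
     valid_sphere S \<and>
     (\<forall>\<tau>\<in>{s, t}. Some (f \<tau>) \<in> sphere_points S \<and>
        sphere_normal S (f \<tau>) \<bullet> vector_derivative f (at \<tau>) = 0)"

definition plane_coord :: "real ^ 3 \<Rightarrow> complex" where
  "plane_coord x = Complex (x $ 1) (x $ 2)"

text \<open>\<open>dw \<and> dz / (w - z)\<^sup>2\<close>; as \<open>plane_coord\<close> is linear, it is its own differential.\<close>

definition cross_ratio_form :: "((real ^ 3) \<times> (real ^ 3), complex) form2" where
  "cross_ratio_form = (\<lambda>p u v.
     (plane_coord (fst u) * plane_coord (snd v) - plane_coord (fst v) * plane_coord (snd u)) /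
     (plane_coord (fst p) - plane_coord (snd p))\<^sup>2)"

text \<open>The images of the two points have to be finite for the pull-back to make sense.\<close>

definition cross_ratio_transformation ::
    "(real \<Rightarrow> real ^ 3) \<Rightarrow> real \<Rightarrow> real \<Rightarrow> oriented_sphere \<Rightarrow>
     ((real ^ 3) option \<Rightarrow> (real ^ 3) option) \<Rightarrow> bool" where
  "cross_ratio_transformation f s t S T \<longleftrightarrow>
     twice_tangent_sphere f s t S \<and> conformal_transformation T \<and>
     maps_oriented_sphere T S horizontal_plane \<and>
     T (Some (f s)) \<noteq> None \<and> T (Some (f t)) \<noteq> None"

text \<open>At each point \<open>(s, t)\<close> the sphere and the transformation are an arbitrary admissible choice.\<close>

definition Omega_CR :: "(real \<Rightarrow> real ^ 3) \<Rightarrow> (real \<times> real, complex) form2" where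
  "Omega_CR f = (\<lambda>p.
     let (S, T) = (SOME (S, T). cross_ratio_transformation f (fst p) (snd p) S T)
     in pullback (knot_pair f)
          (pullback (map_prod (finite_part T) (finite_part T)) cross_ratio_form) p)"


section \<open>The canonical symplectic form of the cotangent bundle of a sphere\<close>

text \<open>The unit \<open>n\<close>-sphere lies in \<open>\<real>\<^sup>n \<times> \<real>\<close>, the last coordinate being the second component. A
  covector at \<open>x\<close> is represented by its extension to a functional on the ambient space that
  vanishes on the normal line spanned by \<open>x\<close>, so \<open>T\<^sup>*S\<^sup>n\<close> consists of the pairs \<open>(x, \<alpha>)\<close> with
  \<open>norm x = 1\<close> and \<open>\<alpha> x = 0\<close>.\<close>

text \<open>Local coordinates, given by their inverse: \<open>g\<close> sends \<open>(p\<^sub>1, \<dots>, p\<^sub>n)\<close> to the point with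
  these coordinates.\<close>

definition local_coordinates ::
    "(real ^ 'n) set \<Rightarrow> (real ^ 'n \<Rightarrow> (real ^ 'n) \<times> real) \<Rightarrow> bool" where
  "local_coordinates V g \<longleftrightarrow>
     open V \<and> g ` V \<subseteq> sphere 0 1 \<and> C2_on g V \<and> inj_on g V \<and>
     (\<forall>p\<in>V. inj (frechet_derivative g (at p)))"

text \<open>The induced coordinates of the cotangent bundle: \<open>(p, q)\<close> is sent to the covector
  \<open>\<Sum>i. q\<^sub>i dp\<^sub>i\<close> at \<open>g p\<close>, that is the one whose value on the \<open>i\<close>-th coordinate vector is
  \<open>q\<^sub>i\<close>.\<close>

definition cotangent_coordinates ::
    "(real ^ 'n \<Rightarrow> (real ^ 'n) \<times> real) \<Rightarrow> (real ^ 'n) \<times> (real ^ 'n) \<Rightarrow>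
     ((real ^ 'n) \<times> real) \<times> (((real ^ 'n) \<times> real) \<Rightarrow>\<^sub>L real)" where
  "cotangent_coordinates g = (\<lambda>(p, q).
     (g p, THE \<alpha>. blinfun_apply \<alpha> (g p) = 0 \<and>
             (\<forall>i. blinfun_apply \<alpha> (frechet_derivative g (at p) (axis i 1)) = q $ i)))"

text \<open>In all local coordinates the form is \<open>\<Sum>i. dp\<^sub>i \<and> dq\<^sub>i\<close>. This determines it on tangent
  vectors of the cotangent bundle.\<close>

definition is_canonical_symplectic_form ::
    "(((real ^ 'n) \<times> real) \<times> (((real ^ 'n) \<times> real) \<Rightarrow>\<^sub>L real), real) form2 \<Rightarrow> bool" where
  "is_canonical_symplectic_form \<omega> \<longleftrightarrow>
     (\<forall>V g. local_coordinates V g \<longrightarrow>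
        (\<forall>p\<in>V. \<forall>q u v. pullback (cotangent_coordinates g) \<omega> (p, q) u v =
           (\<Sum>i\<in>UNIV. fst u $ i * snd v $ i - fst v $ i * snd u $ i)))"

definition omega_0 ::
    "(((real ^ 'n) \<times> real) \<times> (((real ^ 'n) \<times> real) \<Rightarrow>\<^sub>L real), real) form2" where
  "omega_0 = (SOME \<omega>. is_canonical_symplectic_form \<omega>)"

text \<open>The stereographic projection of \<open>y\<close> from \<open>x\<close>, and \<open>\<psi>\<^sub>n\<close>; the formulas also make sense
  near the sphere, so the latter can be differentiated in the ambient space.\<close>

definition stereographic_from :: "'a::real_inner \<Rightarrow> 'a \<Rightarrow> 'a" where
  "stereographic_from x y = (1 / (1 - x \<bullet> y)) *\<^sub>R (y - (x \<bullet> y) *\<^sub>R x)"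

definition psi ::
    "((real ^ 'n) \<times> real) \<times> ((real ^ 'n) \<times> real) \<Rightarrow>
     ((real ^ 'n) \<times> real) \<times> (((real ^ 'n) \<times> real) \<Rightarrow>\<^sub>L real)" where
  "psi = (\<lambda>(x, y). (x, blinfun_inner_right (stereographic_from x y)))"

definition stereographic :: "(real ^ 'n) \<times> real \<Rightarrow> real ^ 'n" where
  "stereographic = (\<lambda>(x, h). (1 / (1 - h)) *\<^sub>R x)"

definition inverse_stereographic :: "real ^ 'n \<Rightarrow> (real ^ 'n) \<times> real" where
  "inverse_stereographic = inv_into (sphere 0 1 - {(0, 1)}) stereographic"

definition stereographic_pair ::
    "(real ^ 'n) \<times> (real ^ 'n) \<Rightarrow> ((real ^ 'n) \<times> real) \<times> ((real ^ 'n) \<times> real)" where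
  "stereographic_pair = map_prod inverse_stereographic inverse_stereographic"

definition omega_R :: "((real ^ 'n) \<times> (real ^ 'n), real) form2" where
  "omega_R = pullback stereographic_pair (pullback psi omega_0)"

end

theory Submission
  imports Defs
begin

text \<open>
  All three 2-forms are the mixed second derivative of \<open>ln |x - y|\<close>. Put
  \<open>Q = 2 (d \<bullet> a) (d \<bullet> b) / |d|\<^sup>4 - (a \<bullet> b) / |d|\<^sup>2\<close>,
  where \<open>d = x - y\<close> and \<open>a\<close>, \<open>b\<close> are the unit tangents of the knot at \<open>x\<close> and \<open>y\<close>; this is the
  derivative of \<open>ln |x - y|\<close> in the direction \<open>a\<close> of \<open>x\<close> and the direction \<open>b\<close> of \<open>y\<close>
  (\<open>mixed_log_hessian\<close>). Each form equals \<open>Q ds \<and> dt\<close>.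

  For the angle, note that a circle meets its chord at equal angles at both ends, so the tangent at \<open>x\<close> of the circle
  that is tangent to the knot at \<open>y\<close> is the reflection of \<open>b\<close> in the chord. Its inner product
  with \<open>a\<close> is \<open>Q |d|\<^sup>2\<close>, the cosine of the conformal angle (\<open>cos_conformal_angle\<close>).

  For the cross-ratio, note that in the complex plane \<open>dw \<and> dz / (w - z)\<^sup>2\<close> is the mixed derivative of
  \<open>log (w - z)\<close>, whose real part is \<open>ln |w - z|\<close> (\<open>Re_cross_ratio_mixed_log_hessian\<close>). A
  conformal transformation multiplies \<open>|x - y|\<^sup>2\<close> by a product of a function of \<open>x\<close> and a function
  of \<open>y\<close>, and this leaves the mixed derivative of the logarithm unchanged. The proof of this
  invariance (\<open>mixed_log_hessian_conformal\<close>) lifts conformal transformations to linear isometries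
  of a Lorentz form on the light cone model of \<open>\<real>\<^sup>3 \<union> {\<infinity>}\<close>. Since the form \<open>\<Omega>\<close> is given by an
  arbitrary choice of a sphere and a transformation, it also has to be shown that a choice exists
  (\<open>twice_tangent_sphere_exists\<close>, \<open>cross_ratio_transformation_exists_for\<close>).

  For the symplectic form, note that in the chart given by stereographic projection, the covector \<open>\<psi>(x, y)\<close> has the
  coordinates \<open>q = - grad ln |x - y|\<^sup>2\<close> plus the gradient of a function of \<open>x\<close> alone, the gradients
  being taken in \<open>x\<close>. So \<open>\<Sum>i. dx\<^sub>i \<and> dq\<^sub>i\<close> is \<open>- 2\<close> times the mixed derivative of \<open>ln |x - y|\<close>
  (\<open>omega_R_eq\<close>). Here too the form is characterized by a property, its expression in all charts,
  and has to be shown to exist: the ambient form \<open>\<Sum>j. dx\<^sub>j \<and> d\<alpha>\<^sub>j\<close> has this expression, by the symmetry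
  of the second derivative of a chart (\<open>omega_0_canonical\<close>).
\<close>

section \<open>The mixed derivative of the logarithmic distance\<close>

text \<open>The derivative of \<open>ln (norm (x - y))\<close> in the direction \<open>a\<close> of \<open>x\<close> and the direction \<open>b\<close>
of \<open>y\<close>, written out.\<close>
definition mixed_log_hessian :: "'a::real_inner \<Rightarrow> 'a \<Rightarrow> 'a \<Rightarrow> 'a \<Rightarrow> real" where
  "mixed_log_hessian x y a b =
     2 * ((x - y) \<bullet> a) * ((x - y) \<bullet> b) / ((x - y) \<bullet> (x - y))\<^sup>2 - a \<bullet> b / ((x - y) \<bullet> (x - y))"

lemma mixed_log_hessian_scaleR:
  "mixed_log_hessian x y (k *\<^sub>R a) (l *\<^sub>R b) = k * l * mixed_log_hessian x y a b"
  by (simp add: mixed_log_hessian_def right_diff_distrib mult_ac)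

section \<open>The conformal angle\<close>

text \<open>The reflection of \<open>u\<close> in the line spanned by \<open>d\<close>. An oriented circle meets a chord at equal
angles at its two ends, so this map carries its tangent at one end of the chord \<open>d\<close> to its
tangent at the other end.\<close>
definition chord_reflection :: "'a::real_inner \<Rightarrow> 'a \<Rightarrow> 'a" where
  "chord_reflection d u = (2 * (u \<bullet> d) / (d \<bullet> d)) *\<^sub>R d - u"

lemma chord_reflection_scaleR: "chord_reflection d (k *\<^sub>R u) = k *\<^sub>R chord_reflection d u"
  by (simp add: chord_reflection_def algebra_simps)

lemma chord_reflection_minus: "chord_reflection (- d) u = chord_reflection d u"
  by (simp add: chord_reflection_def)

lemma chord_reflection_parallel:
  assumes "norm a = 1" "k \<noteq> 0" shows "chord_reflection (k *\<^sub>R a) a = a"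
proof -
  have "a \<bullet> a = 1" using assms by (simp add: norm_eq_1)
  then have "chord_reflection (k *\<^sub>R a) a = (2 :: real) *\<^sub>R a - a"
    using assms(2) by (simp add: chord_reflection_def)
  then show ?thesis by (simp add: scaleR_2)
qed

lemma inner_chord_reflection: "a \<bullet> chord_reflection d b = chord_reflection d a \<bullet> b"
  by (simp add: chord_reflection_def inner_diff_left inner_diff_right inner_commute)

lemma norm_chord_reflection: "d \<noteq> 0 \<Longrightarrow> norm (chord_reflection d u) = norm u"
  unfolding norm_eq by (simp add: chord_reflection_def algebra_simps inner_commute power2_eq_square)

lemma circle_vector_derivative:
  "((\<lambda>\<tau>. c + (r * cos \<tau>) *\<^sub>R a + (r * sin \<tau>) *\<^sub>R b) has_vector_derivative
     (- r * sin \<tau>) *\<^sub>R a + (r * cos \<tau>) *\<^sub>R b) (at \<tau>)"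
  by (auto intro!: derivative_eq_intros simp: mult.commute)

lemma line_vector_derivative: "((\<lambda>\<tau>. c + \<tau> *\<^sub>R a) has_vector_derivative a) (at \<tau>)"
  by (auto intro!: derivative_eq_intros)

text \<open>Up to sign, the components of \<open>|d|\<^sup>2 (\<gamma>'(\<sigma>) + \<gamma>'(\<tau>)) = 2 (\<gamma>'(\<tau>) \<bullet> d) d\<close> for the unit circle and the chord
\<open>d = \<gamma>(\<sigma>) - \<gamma>(\<tau>)\<close>.\<close>
lemma circle_chord_identity:
  fixes cs ss ct st :: real
  assumes "ss\<^sup>2 + cs\<^sup>2 = 1" "st\<^sup>2 + ct\<^sup>2 = 1"
  shows "(2 - 2 * (cs * ct + ss * st)) * (ss + st) = 2 * (ct * ss - cs * st) * - (cs - ct)"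
    and "(2 - 2 * (cs * ct + ss * st)) * (cs + ct) = 2 * (ct * ss - cs * st) * (ss - st)"
  using assms by algebra+

text \<open>The speed is constant along an oriented circle or line, so the two tangents correspond under
the chord reflection without rescaling.\<close>
lemma oriented_circle_tangents:
  assumes "oriented_circle \<gamma>"
  shows "\<gamma> \<sigma> = \<gamma> \<tau> \<Longrightarrow> vector_derivative \<gamma> (at \<sigma>) = vector_derivative \<gamma> (at \<tau>)"
    and "\<gamma> \<sigma> \<noteq> \<gamma> \<tau> \<Longrightarrow> vector_derivative \<gamma> (at \<sigma>) =
      chord_reflection (\<gamma> \<sigma> - \<gamma> \<tau>) (vector_derivative \<gamma> (at \<tau>))"
proof -
  have "(\<gamma> \<sigma> = \<gamma> \<tau> \<longrightarrow> vector_derivative \<gamma> (at \<sigma>) = vector_derivative \<gamma> (at \<tau>)) \<and>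
    (\<gamma> \<sigma> \<noteq> \<gamma> \<tau> \<longrightarrow> vector_derivative \<gamma> (at \<sigma>) =
      chord_reflection (\<gamma> \<sigma> - \<gamma> \<tau>) (vector_derivative \<gamma> (at \<tau>)))"
    using assms unfolding oriented_circle_def
  proof (elim disjE exE conjE)
    fix c a b :: "real ^ 3" and r :: real
    assume r: "r > 0" and "norm a = 1" "norm b = 1" and ab: "a \<bullet> b = 0"
      and \<gamma>: "\<gamma> = (\<lambda>\<tau>. c + (r * cos \<tau>) *\<^sub>R a + (r * sin \<tau>) *\<^sub>R b)"
    then have aa: "a \<bullet> a = 1" "b \<bullet> b = 1" "b \<bullet> a = 0"
      by (auto simp: norm_eq_1 inner_commute)
    have vd: "vector_derivative \<gamma> (at \<tau>) = (- r * sin \<tau>) *\<^sub>R a + (r * cos \<tau>) *\<^sub>R b" for \<tau>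
      unfolding \<gamma> by (rule vector_derivative_at[OF circle_vector_derivative])
    define d where "d = \<gamma> \<sigma> - \<gamma> \<tau>"
    have d: "d = (r * (cos \<sigma> - cos \<tau>)) *\<^sub>R a + (r * (sin \<sigma> - sin \<tau>)) *\<^sub>R b"
      by (simp add: d_def \<gamma> algebra_simps)
    have same: "vector_derivative \<gamma> (at \<sigma>) = vector_derivative \<gamma> (at \<tau>)" if "\<gamma> \<sigma> = \<gamma> \<tau>"
    proof -
      have "d = 0" using that by (simp add: d_def)
      then have "d \<bullet> a = 0" "d \<bullet> b = 0" by simp_all
      then show ?thesis using r by (simp add: d inner_add_left aa ab vd)
    qed
    have opp: "vector_derivative \<gamma> (at \<sigma>) = chord_reflection (\<gamma> \<sigma> - \<gamma> \<tau>) (vector_derivative \<gamma> (at \<tau>))"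
      if "\<gamma> \<sigma> \<noteq> \<gamma> \<tau>"
    proof -
      define N where "N = 2 - 2 * (cos \<sigma> * cos \<tau> + sin \<sigma> * sin \<tau>)"
      have dd: "d \<bullet> d = r\<^sup>2 * N"
      proof -
        have "d \<bullet> d = (r * (cos \<sigma> - cos \<tau>))\<^sup>2 + (r * (sin \<sigma> - sin \<tau>))\<^sup>2"
          unfolding d by (simp add: inner_add_left inner_add_right aa ab power2_eq_square)
        then show ?thesis
          using sin_cos_squared_add[of \<sigma>] sin_cos_squared_add[of \<tau>] unfolding N_def by algebra
      qed
      then have N: "N \<noteq> 0" using that by (auto simp: d_def)
      define S where "S = cos \<tau> * sin \<sigma> - cos \<sigma> * sin \<tau>"
      have vdd: "vector_derivative \<gamma> (at \<tau>) \<bullet> d = r\<^sup>2 * S"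
        unfolding vd d S_def
        by (simp add: inner_diff_left inner_add_left inner_add_right aa ab) algebra
      have id: "N * (sin \<sigma> + sin \<tau>) = 2 * S * - (cos \<sigma> - cos \<tau>)"
        "N * (cos \<sigma> + cos \<tau>) = 2 * S * (sin \<sigma> - sin \<tau>)"
        unfolding N_def S_def by (intro circle_chord_identity sin_cos_squared_add)+
      have "2 * S / N * (cos \<sigma> - cos \<tau>) = - (sin \<sigma> + sin \<tau>)" "2 * S / N * (sin \<sigma> - sin \<tau>) = cos \<sigma> + cos \<tau>"
        using id N by (simp_all add: field_simps)
      then have "(2 * S / N) *\<^sub>R d = (r * - (sin \<sigma> + sin \<tau>)) *\<^sub>R a + (r * (cos \<sigma> + cos \<tau>)) *\<^sub>R b"
        unfolding d by (simp add: scaleR_add_right mult.left_commute[of _ r])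
      then have "vector_derivative \<gamma> (at \<sigma>) = (2 * S / N) *\<^sub>R d - vector_derivative \<gamma> (at \<tau>)"
        by (simp add: vd algebra_simps)
      moreover have "2 * (vector_derivative \<gamma> (at \<tau>) \<bullet> d) / (d \<bullet> d) = 2 * S / N"
        unfolding vdd dd using r by simp
      ultimately show ?thesis by (simp add: chord_reflection_def d_def)
    qed
    from same opp show ?thesis by blast
  next
    fix c a :: "real ^ 3"
    assume a: "norm a = 1" and \<gamma>: "\<gamma> = (\<lambda>\<tau>. c + \<tau> *\<^sub>R a)"
    have vd: "vector_derivative \<gamma> (at \<tau>) = a" for \<tau>
      unfolding \<gamma> by (rule vector_derivative_at[OF line_vector_derivative])
    have "a = chord_reflection (\<gamma> \<sigma> - \<gamma> \<tau>) a" if "\<gamma> \<sigma> \<noteq> \<gamma> \<tau>"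
    proof -
      have "\<gamma> \<sigma> - \<gamma> \<tau> = (\<sigma> - \<tau>) *\<^sub>R a" by (simp add: \<gamma> algebra_simps)
      moreover have "\<sigma> - \<tau> \<noteq> 0" using that by auto
      ultimately show ?thesis using chord_reflection_parallel[OF a] by metis
    qed
    then show ?thesis by (simp add: vd)
  qed
  then show "\<gamma> \<sigma> = \<gamma> \<tau> \<Longrightarrow> vector_derivative \<gamma> (at \<sigma>) = vector_derivative \<gamma> (at \<tau>)"
    and "\<gamma> \<sigma> \<noteq> \<gamma> \<tau> \<Longrightarrow> vector_derivative \<gamma> (at \<sigma>) =
      chord_reflection (\<gamma> \<sigma> - \<gamma> \<tau>) (vector_derivative \<gamma> (at \<tau>))"
    by blast+
qed

lemma tangent_circle_derivatives:
  assumes "tangent_circle x u y \<gamma>" "x \<noteq> y"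
  obtains k where "k > 0" "\<And>\<sigma>. \<gamma> \<sigma> = x \<Longrightarrow> vector_derivative \<gamma> (at \<sigma>) = k *\<^sub>R u"
    "\<And>\<sigma>. \<gamma> \<sigma> = y \<Longrightarrow> vector_derivative \<gamma> (at \<sigma>) = k *\<^sub>R chord_reflection (x - y) u"
proof -
  obtain \<tau> k where c: "oriented_circle \<gamma>" and k: "k > 0" "\<gamma> \<tau> = x"
    "(\<gamma> has_vector_derivative k *\<^sub>R u) (at \<tau>)"
    using assms(1) unfolding tangent_circle_def by blast
  have \<tau>: "vector_derivative \<gamma> (at \<tau>) = k *\<^sub>R u"
    using k(3) by (rule vector_derivative_at)
  show thesis
  proof
    fix \<sigma>
    show "vector_derivative \<gamma> (at \<sigma>) = k *\<^sub>R u" if "\<gamma> \<sigma> = x"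
      using oriented_circle_tangents[OF c, of \<sigma> \<tau>] that k(2) \<tau> by metis
    show "vector_derivative \<gamma> (at \<sigma>) = k *\<^sub>R chord_reflection (x - y) u" if "\<gamma> \<sigma> = y"
      using oriented_circle_tangents[OF c, of \<sigma> \<tau>] that k(2) \<tau> assms(2)
        chord_reflection_minus[of "x - y"] chord_reflection_scaleR by (metis minus_diff_eq)
  qed (rule k(1))
qed

text \<open>If \<open>u\<close> points along the chord the circle is a line. Otherwise its centre lies on the normal to
\<open>u\<close> at \<open>x\<close> in the plane of \<open>u\<close> and the chord, at the distance \<open>r\<close> that makes it equidistant
from \<open>x\<close> and \<open>y\<close>.\<close>
lemma tangent_circle_exists:
  assumes "x \<noteq> y" "norm u = 1"
  obtains \<gamma> where "tangent_circle x u y \<gamma>"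
proof -
  define d where "d = y - x"
  define w where "w = d - (d \<bullet> u) *\<^sub>R u"
  have uu: "u \<bullet> u = 1" using assms(2) by (simp add: norm_eq_1)
  show thesis
  proof (cases "w = 0")
    case True
    then have "y = x + (d \<bullet> u) *\<^sub>R u" by (simp add: w_def d_def algebra_simps)
    then have "y \<in> range (\<lambda>\<tau>. x + \<tau> *\<^sub>R u)" by blast
    moreover have "oriented_circle (\<lambda>\<tau>. x + \<tau> *\<^sub>R u)"
      using assms(2) unfolding oriented_circle_def by blast
    ultimately have "tangent_circle x u y (\<lambda>\<tau>. x + \<tau> *\<^sub>R u)"
      unfolding tangent_circle_def using line_vector_derivative[of x u 0]
      by (intro conjI exI[of _ 0] exI[of _ 1]) auto
    then show ?thesis by (rule that)
  next
    case False
    define n where "n = w /\<^sub>R norm w"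
    define r where "r = (d \<bullet> d) / (2 * norm w)"
    have w: "norm w > 0" using False by simp
    have r: "r > 0" using w assms(1) by (simp add: r_def d_def)
    have wu: "w \<bullet> u = 0" by (simp add: w_def inner_diff_left uu)
    have n: "norm n = 1" "n \<bullet> u = 0" "u \<bullet> n = 0"
      using w wu by (auto simp: n_def inner_commute)
    have dn: "d = (d \<bullet> u) *\<^sub>R u + norm w *\<^sub>R n"
      using w by (simp add: n_def w_def)
    have dd: "d \<bullet> d = (d \<bullet> u)\<^sup>2 + (norm w)\<^sup>2"
      using n uu by (subst dn, subst (2) dn) (simp add: inner_add_left inner_add_right power2_eq_square norm_eq_1)
    define c where "c = x + r *\<^sub>R n"
    define \<gamma> where "\<gamma> = (\<lambda>\<tau>. c + (r * cos \<tau>) *\<^sub>R (- n) + (r * sin \<tau>) *\<^sub>R u)"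
    have "((r - norm w) / r)\<^sup>2 + ((d \<bullet> u) / r)\<^sup>2 = 1"
    proof -
      have "(r - norm w)\<^sup>2 + (d \<bullet> u)\<^sup>2 = r\<^sup>2 - 2 * r * norm w + d \<bullet> d"
        unfolding dd by (simp add: power2_eq_square algebra_simps)
      also have "\<dots> = r\<^sup>2" using w by (simp add: r_def)
      finally show ?thesis using r by (simp add: power_divide flip: add_divide_distrib)
    qed
    then obtain \<tau> where "(r - norm w) / r = cos \<tau>" "(d \<bullet> u) / r = sin \<tau>"
      using sincos_total_2pi by metis
    then have \<tau>: "r * cos \<tau> = r - norm w" "r * sin \<tau> = d \<bullet> u"
      using r by (auto simp: field_simps)
    have "y = x + d" by (simp add: d_def)
    also have "\<dots> = x + ((d \<bullet> u) *\<^sub>R u + norm w *\<^sub>R n)" using dn by simp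
    also have "\<dots> = \<gamma> \<tau>" by (simp add: \<gamma>_def \<tau> c_def algebra_simps)
    finally have y: "y = \<gamma> \<tau>" .
    have "oriented_circle \<gamma>"
      unfolding oriented_circle_def \<gamma>_def using r n assms(2)
      by (intro disjI1 exI[of _ c] exI[of _ r] exI[of _ "- n"] exI[of _ u]) auto
    moreover have "\<gamma> 0 = x" by (simp add: \<gamma>_def c_def)
    moreover have "(\<gamma> has_vector_derivative r *\<^sub>R u) (at 0)"
      using circle_vector_derivative[of c r "- n" u 0] by (simp add: \<gamma>_def)
    ultimately have "tangent_circle x u y \<gamma>"
      using r y unfolding tangent_circle_def by blast
    then show ?thesis by (rule that)
  qed
qed

lemma vector_angle_scaleR:
  "k > 0 \<Longrightarrow> l > 0 \<Longrightarrow> vector_angle (k *\<^sub>R u) (l *\<^sub>R v) = vector_angle u v"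
  by (simp add: vector_angle_def)

text \<open>Every pair of tangent circles has the same angle at both points, because the reflection in the
chord is orthogonal and an involution: at \<open>x\<close> the cosine is \<open>a \<bullet> chord_reflection d b\<close>, at \<open>y\<close>
it is \<open>chord_reflection d a \<bullet> b\<close>, where \<open>d = x - y\<close>. So the description of the angle has a
unique solution, and expanding the inner product gives the mixed derivative.\<close>
lemma cos_conformal_angle:
  assumes "f s \<noteq> f t" "norm (vector_derivative f (at s)) = 1" "norm (vector_derivative f (at t)) = 1"
  shows "cos (conformal_angle f s t) = (norm (f s - f t))\<^sup>2 *
    mixed_log_hessian (f s) (f t) (vector_derivative f (at s)) (vector_derivative f (at t))"
proof -
  define x y a b where "x = f s" and "y = f t" and "a = vector_derivative f (at s)" and "b = vector_derivative f (at t)"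
  note defs = x_def[symmetric] y_def[symmetric] a_def[symmetric] b_def[symmetric]
  have xy: "x \<noteq> y" "y \<noteq> x" and a: "norm a = 1" and b: "norm b = 1"
    using assms by (auto simp: defs)
  define q where "q = a \<bullet> chord_reflection (x - y) b"
  have q2: "q = chord_reflection (x - y) a \<bullet> b"
    unfolding q_def by (rule inner_chord_reflection)
  have norms: "norm (chord_reflection (x - y) a) = 1" "norm (chord_reflection (x - y) b) = 1"
    using xy a b by (simp_all add: norm_chord_reflection)
  have angle: "\<theta> = arccos q \<longleftrightarrow> (angle_of_curves_at \<gamma> \<delta> x \<theta> \<or> angle_of_curves_at \<gamma> \<delta> y \<theta>)"
    if \<gamma>: "tangent_circle x a y \<gamma>" and \<delta>: "tangent_circle y b x \<delta>" for \<gamma> \<delta> \<theta>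
  proof -
    obtain k where k: "k > 0" "\<And>\<sigma>. \<gamma> \<sigma> = x \<Longrightarrow> vector_derivative \<gamma> (at \<sigma>) = k *\<^sub>R a"
        "\<And>\<sigma>. \<gamma> \<sigma> = y \<Longrightarrow> vector_derivative \<gamma> (at \<sigma>) = k *\<^sub>R chord_reflection (x - y) a"
      using tangent_circle_derivatives[OF \<gamma> xy(1)] by metis
    obtain l where l: "l > 0" "\<And>\<sigma>. \<delta> \<sigma> = y \<Longrightarrow> vector_derivative \<delta> (at \<sigma>) = l *\<^sub>R b"
        "\<And>\<sigma>. \<delta> \<sigma> = x \<Longrightarrow> vector_derivative \<delta> (at \<sigma>) = l *\<^sub>R chord_reflection (y - x) b"
      using tangent_circle_derivatives[OF \<delta> xy(2)] by metis
    have rev: "chord_reflection (y - x) b = chord_reflection (x - y) b"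
      using chord_reflection_minus[of "x - y" b] by simp
    have "vector_angle a (chord_reflection (x - y) b) = arccos q" "vector_angle (chord_reflection (x - y) a) b = arccos q"
      using a b norms by (simp_all add: vector_angle_def q_def[symmetric] q2[symmetric])
    then have 1: "angle_of_curves_at \<gamma> \<delta> z \<theta> \<Longrightarrow> \<theta> = arccos q" if "z = x \<or> z = y" for z \<theta>
      using that k l unfolding angle_of_curves_at_def by (auto simp: rev vector_angle_scaleR)
    obtain \<sigma> \<tau> where "\<gamma> \<sigma> = x" "\<delta> \<tau> = x"
      using \<gamma> \<delta> unfolding tangent_circle_def by blast
    then have "angle_of_curves_at \<gamma> \<delta> x (vector_angle (vector_derivative \<gamma> (at \<sigma>)) (vector_derivative \<delta> (at \<tau>)))"
      unfolding angle_of_curves_at_def by blast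
    moreover from 1[OF disjI1[OF refl] this] this have "angle_of_curves_at \<gamma> \<delta> x (arccos q)"
      by simp
    ultimately show ?thesis using 1[of x \<theta>] 1[of y \<theta>] by auto
  qed
  obtain \<gamma>0 \<delta>0 where "tangent_circle x a y \<gamma>0" "tangent_circle y b x \<delta>0"
    using tangent_circle_exists xy a b by metis
  then have "conformal_angle f s t = arccos q"
    unfolding conformal_angle_def defs
    by (intro the_equality) (use angle in blast)+
  moreover have "\<bar>q\<bar> \<le> 1"
    using Cauchy_Schwarz_ineq2[of a "chord_reflection (x - y) b"] a norms by (simp add: q_def)
  then have "cos (arccos q) = q" by (simp add: cos_arccos_abs)
  moreover have "q = (norm (x - y))\<^sup>2 * mixed_log_hessian x y a b"
  proof -
    define d where "d = x - y"
    have "d \<bullet> d \<noteq> 0" using xy by (simp add: d_def)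
    then show ?thesis
      unfolding q_def chord_reflection_def mixed_log_hessian_def power2_norm_eq_inner d_def[symmetric]
      by (simp add: inner_diff_right right_diff_distrib power2_eq_square inner_commute)
  qed
  ultimately show ?thesis by (simp add: defs)
qed

section \<open>Symmetry of second derivatives\<close>

text \<open>The second difference is the increment over \<open>[0, t]\<close> of \<open>h s = g (p + s u + t v) - g (p + s u)\<close>.
By the mean value theorem it is \<open>t\<close> times a difference of two values of \<open>g'\<close> near \<open>p\<close>, which
\<open>g''\<close> determines up to \<open>o(t)\<close>.\<close>
lemma second_difference_quotient:
  fixes g :: "'a::real_normed_vector \<Rightarrow> real" and g' :: "'a \<Rightarrow> 'a \<Rightarrow>\<^sub>L real"
  assumes "open V" "p \<in> V" "\<And>x. x \<in> V \<Longrightarrow> (g has_derivative g' x) (at x)"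
    and g'': "(g' has_derivative g'') (at p)" and "\<epsilon> > 0"
  shows "\<forall>\<^sub>F t in at_right 0.
    \<bar>g (p + t *\<^sub>R u + t *\<^sub>R v) - g (p + t *\<^sub>R u) - g (p + t *\<^sub>R v) + g p - t\<^sup>2 * g'' v u\<bar> \<le> \<epsilon> * t\<^sup>2"
proof -
  interpret g'': bounded_linear g'' using g'' by (rule has_derivative_bounded_linear)
  define N where "N = norm u + norm v + 1"
  have N: "N > 0" by (simp add: N_def add_nonneg_pos)
  \<comment> \<open>The error bound for \<open>g'\<close> is used at two points at distance at most \<open>t * N\<close> from \<open>p\<close>.\<close>
  define \<eta> where "\<eta> = \<epsilon> / (2 * N\<^sup>2)"
  have \<eta>: "\<eta> > 0" using N \<open>\<epsilon> > 0\<close> by (simp add: \<eta>_def)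
  obtain \<delta> where \<delta>: "\<delta> > 0" "\<And>z. norm (z - p) < \<delta> \<Longrightarrow> norm (g' z - g' p - g'' (z - p)) \<le> \<eta> * norm (z - p)"
    using g'' \<eta> unfolding has_derivative_at_alt by blast
  obtain \<rho> where \<rho>: "\<rho> > 0" "ball p \<rho> \<subseteq> V"
    using assms(1,2) open_contains_ball by blast
  define t0 where "t0 = min \<delta> \<rho> / N"
  have "t0 > 0" using \<delta> \<rho> N by (simp add: t0_def)
  have main: "\<bar>g (p + t *\<^sub>R u + t *\<^sub>R v) - g (p + t *\<^sub>R u) - g (p + t *\<^sub>R v) + g p - t\<^sup>2 * g'' v u\<bar> \<le> \<epsilon> * t\<^sup>2"
    if t: "0 < t" "t < t0" for t
  proof -
    have tN: "t * N < \<delta>" "t * N < \<rho>"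
      using t N by (auto simp: t0_def field_simps)
    have small: "norm (s *\<^sub>R u + r *\<^sub>R v) \<le> t * N" if "0 \<le> s" "s \<le> t" "0 \<le> r" "r \<le> t" for s r
    proof -
      have "norm (s *\<^sub>R u + r *\<^sub>R v) \<le> s * norm u + r * norm v"
        using that by (metis norm_triangle_ineq norm_scaleR abs_of_nonneg)
      also have "\<dots> \<le> t * norm u + t * norm v"
        using that by (intro add_mono mult_right_mono) auto
      also have "\<dots> \<le> t * N" using t by (simp add: N_def algebra_simps)
      finally show ?thesis .
    qed
    have inV: "p + (s *\<^sub>R u + r *\<^sub>R v) \<in> V" if "0 \<le> s" "s \<le> t" "0 \<le> r" "r \<le> t" for s r
      using small[OF that] tN \<rho>(2) by (metis add_diff_cancel_left' dist_commute dist_norm le_less_trans mem_ball subsetD)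
    define h where "h s = g (p + (s *\<^sub>R u + t *\<^sub>R v)) - g (p + (s *\<^sub>R u + 0 *\<^sub>R v))" for s
    have h': "(h has_real_derivative g' (p + (s *\<^sub>R u + t *\<^sub>R v)) u - g' (p + (s *\<^sub>R u + 0 *\<^sub>R v)) u) (at s)"
      if s: "0 \<le> s" "s \<le> t" for s
    proof -
      have *: "((\<lambda>s. g (p + (s *\<^sub>R u + r *\<^sub>R v))) has_derivative (\<lambda>k. g' (p + (s *\<^sub>R u + r *\<^sub>R v)) (k *\<^sub>R u))) (at s)"
        if "0 \<le> r" "r \<le> t" for r
      proof -
        have "((\<lambda>s. p + (s *\<^sub>R u + r *\<^sub>R v)) has_derivative (\<lambda>k. k *\<^sub>R u)) (at s)"
          by (auto intro!: derivative_eq_intros)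
        from has_derivative_compose[OF this assms(3)[OF inV[OF s that]]]
        show ?thesis .
      qed
      have "(h has_derivative (\<lambda>k. g' (p + (s *\<^sub>R u + t *\<^sub>R v)) (k *\<^sub>R u) - g' (p + (s *\<^sub>R u + 0 *\<^sub>R v)) (k *\<^sub>R u))) (at s)"
        unfolding h_def[abs_def] using t by (intro has_derivative_diff *) auto
      then show ?thesis
        by (rule has_derivative_imp_has_field_derivative) (simp add: blinfun.scaleR_right algebra_simps)
    qed
    obtain \<xi> where \<xi>: "0 < \<xi>" "\<xi> < t"
        "h t - h 0 = (t - 0) * (g' (p + (\<xi> *\<^sub>R u + t *\<^sub>R v)) u - g' (p + (\<xi> *\<^sub>R u + 0 *\<^sub>R v)) u)"
      using MVT2[OF t(1) h'] by blast
    define E where "E r = g' (p + (\<xi> *\<^sub>R u + r *\<^sub>R v)) - g' p - g'' (\<xi> *\<^sub>R u + r *\<^sub>R v)" for r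
    have E: "norm (E r) \<le> \<eta> * (t * N)" if "0 \<le> r" "r \<le> t" for r
    proof -
      have "norm (\<xi> *\<^sub>R u + r *\<^sub>R v) \<le> t * N" using small \<xi> that by simp
      moreover from this have "norm (E r) \<le> \<eta> * norm (\<xi> *\<^sub>R u + r *\<^sub>R v)"
        using \<delta>(2)[of "p + (\<xi> *\<^sub>R u + r *\<^sub>R v)"] tN by (simp add: E_def)
      ultimately show ?thesis using \<eta> by (meson mult_left_mono order_trans less_imp_le)
    qed
    have "h t - h 0 - t\<^sup>2 * g'' v u = t * (E t u - E 0 u)"
      unfolding \<xi>(3) by (simp add: E_def g''.add g''.scaleR blinfun.bilinear_simps power2_eq_square algebra_simps)
    also have "\<bar>\<dots>\<bar> \<le> t * (norm (E t) * norm u + norm (E 0) * norm u)"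
      using t norm_blinfun[of "E t" u] norm_blinfun[of "E 0" u]
      by (simp add: abs_mult)
    also have "\<dots> \<le> t * (\<eta> * (t * N) * N + \<eta> * (t * N) * N)"
      using t \<eta> N E[of t] E[of 0]
      by (intro mult_left_mono add_mono mult_mono) (auto simp: N_def)
    also have "\<dots> = \<epsilon> * t\<^sup>2"
      using N by (simp add: \<eta>_def power2_eq_square)
    finally show ?thesis by (simp add: h_def algebra_simps)
  qed
  show ?thesis
    unfolding eventually_at_right_field using main \<open>t0 > 0\<close> by auto
qed

text \<open>The second difference is symmetric in \<open>u\<close> and \<open>v\<close>, so both \<open>g'' v u\<close> and \<open>g'' u v\<close> are its
limit after division by \<open>t\<^sup>2\<close>. The mean value theorem requires real values, hence the detour
through the inner products with \<open>w\<close>.\<close>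
lemma second_derivative_symmetric:
  fixes g :: "'a::real_normed_vector \<Rightarrow> 'b::real_inner" and g' :: "'a \<Rightarrow> 'a \<Rightarrow>\<^sub>L 'b"
  assumes "open V" "p \<in> V" "\<And>x. x \<in> V \<Longrightarrow> (g has_derivative g' x) (at x)"
    and g'': "(g' has_derivative g'') (at p)"
  shows "g'' u v = g'' v u"
proof -
  have "g'' u v \<bullet> w = g'' v u \<bullet> w" for w
  proof (rule ccontr)
    assume ne: "g'' u v \<bullet> w \<noteq> g'' v u \<bullet> w"
    define \<epsilon> where "\<epsilon> = \<bar>g'' u v \<bullet> w - g'' v u \<bullet> w\<bar> / 3"
    have \<epsilon>: "\<epsilon> > 0" using ne by (simp add: \<epsilon>_def)
    define G where "G x = g x \<bullet> w" for x
    define G' where "G' x = blinfun_inner_left w o\<^sub>L g' x" for x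
    define G'' where "G'' x = blinfun_inner_left w o\<^sub>L g'' x" for x
    have 1: "(G has_derivative G' x) (at x)" if "x \<in> V" for x
      unfolding G_def[abs_def] G'_def using assms(3)[OF that]
      by (auto intro!: derivative_eq_intros)
    have 2: "(G' has_derivative G'') (at p)"
      unfolding G'_def[abs_def] G''_def[abs_def] using g''
      by (auto intro!: derivative_eq_intros)
    note diff = second_difference_quotient[where g' = G', OF assms(1,2) _ 2 \<epsilon>, OF 1, simplified]
    have "\<forall>\<^sub>F t in at_right (0::real). \<bar>G'' v u - G'' u v\<bar> \<le> 2 * \<epsilon>"
      using diff[of u v] diff[of v u]
        eventually_at_right_less[of "0::real"]
    proof eventually_elim
      case (elim t)
      have "\<bar>t\<^sup>2 * G'' v u - t\<^sup>2 * G'' u v\<bar> \<le> t\<^sup>2 * (2 * \<epsilon>)"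
        using elim(1,2) by (simp add: algebra_simps)
      then have "t\<^sup>2 * \<bar>G'' v u - G'' u v\<bar> \<le> t\<^sup>2 * (2 * \<epsilon>)"
        by (metis abs_mult abs_power2 right_diff_distrib)
      then show ?case using elim(3) by (simp add: mult_le_cancel_left_pos)
    qed
    then have "\<bar>G'' v u - G'' u v\<bar> \<le> 2 * \<epsilon>" by simp
    then show False using ne by (simp add: G''_def \<epsilon>_def abs_if split: if_splits)
  qed
  then show ?thesis by (metis vector_eq_rdot)
qed

section \<open>The canonical symplectic form in ambient coordinates\<close>

lemma blinfun_eq_inner_right:
  fixes \<alpha> :: "'e::euclidean_space \<Rightarrow>\<^sub>L real"
  shows "\<alpha> = blinfun_inner_right (\<Sum>b\<in>Basis. \<alpha> b *\<^sub>R b)"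
  by (rule blinfun_euclidean_eqI) (simp add: inner_sum_left inner_Basis if_distrib cong: if_cong)

text \<open>Local coordinates of the sphere together with named derivatives of the parametrization.\<close>
locale sphere_chart =
  fixes V :: "(real ^ 'n) set" and g :: "real ^ 'n \<Rightarrow> (real ^ 'n) \<times> real"
    and g' :: "real ^ 'n \<Rightarrow> (real ^ 'n) \<Rightarrow>\<^sub>L ((real ^ 'n) \<times> real)"
    and g'' :: "real ^ 'n \<Rightarrow> (real ^ 'n) \<Rightarrow>\<^sub>L ((real ^ 'n) \<Rightarrow>\<^sub>L ((real ^ 'n) \<times> real))"
  assumes open_V: "open V"
    and norm_g: "p \<in> V \<Longrightarrow> norm (g p) = 1"
    and g': "p \<in> V \<Longrightarrow> (g has_derivative g' p) (at p)"
    and g'': "p \<in> V \<Longrightarrow> (g' has_derivative g'' p) (at p)"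
    and inj_g': "p \<in> V \<Longrightarrow> inj (g' p)"
begin

lemma frechet_derivative_chart: "p \<in> V \<Longrightarrow> frechet_derivative g (at p) = g' p"
  using frechet_derivative_at[OF g'] by simp

lemma g_orthogonal_g': "g p \<bullet> g' p h = 0" if "p \<in> V"
proof -
  have "((\<lambda>x. g x \<bullet> g x) has_derivative (\<lambda>h. g p \<bullet> g' p h + g' p h \<bullet> g p)) (at p)"
    using g'[OF that] by (auto intro!: derivative_eq_intros)
  moreover have "((\<lambda>x. g x \<bullet> g x) has_derivative (\<lambda>h. 0)) (at p)"
    by (rule has_derivative_transform_within_open[OF has_derivative_const open_V that, of 1])
      (simp add: norm_g flip: power2_norm_eq_inner)
  ultimately have "(\<lambda>h. g p \<bullet> g' p h + g' p h \<bullet> g p) = (\<lambda>h. 0)"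
    by (rule has_derivative_unique)
  then have "g p \<bullet> g' p h + g' p h \<bullet> g p = 0" by (rule fun_cong)
  then show ?thesis by (simp add: inner_commute)
qed

text \<open>The values of the functional \<open>A \<bullet> _\<close> on the coordinate vectors and on the normal \<open>g p\<close>. As
these vectors form a basis, the values determine \<open>A\<close>.\<close>
definition frame_values :: "real ^ 'n \<Rightarrow> (real ^ 'n) \<times> real \<Rightarrow> (real ^ 'n) \<times> real" where
  "frame_values p A = (\<Sum>i\<in>UNIV. (A \<bullet> g' p (axis i (1::real))) *\<^sub>R axis i (1::real), A \<bullet> g p)"

lemma fst_frame_values: "fst (frame_values p A) $ i = A \<bullet> g' p (axis i (1::real))"
proof -
  have "(\<Sum>j\<in>UNIV. c j * axis j (1::real) $ i) = c i" for c :: "'n \<Rightarrow> real"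
    by (subst sum.remove[of _ i]) (auto simp: axis_def intro!: sum.neutral)
  then show ?thesis by (simp add: frame_values_def)
qed

lemma fst_frame_values_inner: "fst (frame_values p A) \<bullet> w = A \<bullet> g' p w"
proof -
  have w: "w = (\<Sum>i\<in>UNIV. w $ i *\<^sub>R axis i (1::real))"
    using basis_expansion[of w] by (simp add: scalar_mult_eq_scaleR)
  have "A \<bullet> g' p w = A \<bullet> g' p (\<Sum>i\<in>UNIV. w $ i *\<^sub>R axis i (1::real))"
    by (rule arg_cong[OF w])
  also have "\<dots> = (\<Sum>i\<in>UNIV. w $ i * (A \<bullet> g' p (axis i (1::real))))"
    by (simp add: blinfun.sum_right blinfun.scaleR_right inner_sum_right)
  also have "\<dots> = fst (frame_values p A) \<bullet> w"
    by (simp add: inner_vec_def fst_frame_values mult.commute)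
  finally show ?thesis by simp
qed

lemma linear_frame_values: "linear (frame_values p)"
  by (rule linearI)
    (auto simp: frame_values_def inner_add_left scaleR_add_left sum.distrib scaleR_sum_right)

text \<open>The normal \<open>g p\<close> is orthogonal to the image of \<open>g' p\<close>, so \<open>E\<close> is injective, and therefore
onto for reasons of dimension: a vector orthogonal to the frame is orthogonal to itself.\<close>
lemma inj_frame_values: "inj (frame_values p)" if p: "p \<in> V"
proof -
  have "A = 0" if "frame_values p A = 0" for A
  proof -
    define E where "E z = g' p (fst z) + snd z *\<^sub>R g p" for z :: "(real ^ 'n) \<times> real"
    have "linear E"
      by (rule linearI) (auto simp: E_def blinfun.bilinear_simps algebra_simps)
    moreover have "z = 0" if "E z = 0" for z
    proof -
      have "snd z = E z \<bullet> g p"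
        using norm_g[OF p] by (simp add: E_def inner_left_distrib inner_commute[of "g' p _"]
            g_orthogonal_g'[OF p] flip: power2_norm_eq_inner)
      then have "snd z = 0" using that by simp
      then have "g' p (fst z) = g' p 0" using that by (simp add: E_def)
      then have "fst z = 0" using inj_g'[OF p] by (meson injD)
      with \<open>snd z = 0\<close> show ?thesis by (simp add: prod_eq_iff)
    qed
    ultimately have "surj E"
      by (intro linear_inj_imp_surj) (simp_all add: linear_injective_0)
    then obtain z where "A = E z" by (metis surjD)
    moreover have "A \<bullet> E z = 0"
      using that fst_frame_values_inner[of p A "fst z"]
      by (simp add: E_def inner_right_distrib prod_eq_iff) (simp add: frame_values_def)
    ultimately show ?thesis by simp
  qed
  then show ?thesis by (simp add: linear_injective_0[OF linear_frame_values])
qed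

text \<open>The map from covectors to their fibre coordinates, with the base point kept in the chart, and
extended by the value on the normal so that domain and codomain have the same dimension.\<close>
definition covector_map where
  "covector_map z = (fst z, frame_values (fst z) (snd z))"

definition covector_map' where
  "covector_map' z h = (fst h,
     \<Sum>i\<in>UNIV. (snd h \<bullet> g' (fst z) (axis i (1::real)) + snd z \<bullet> g'' (fst z) (fst h) (axis i (1::real))) *\<^sub>R axis i (1::real),
     snd h \<bullet> g (fst z) + snd z \<bullet> g' (fst z) (fst h))"

definition covector_inverse where
  "covector_inverse y = (fst y, inv (frame_values (fst y)) (snd y))"

lemma covector_inverse_covector_map: "fst z \<in> V \<Longrightarrow> covector_inverse (covector_map z) = z"
  by (simp add: covector_inverse_def covector_map_def inv_f_f[OF inj_frame_values])

lemma frame_values_inv: "p \<in> V \<Longrightarrow> frame_values p (inv (frame_values p) r) = r"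
  by (rule surj_f_inv_f[OF linear_inj_imp_surj[OF linear_frame_values inj_frame_values]])

lemma covector_map_has_derivative:
  assumes "fst z \<in> V" shows "(covector_map has_derivative covector_map' z) (at z)"
proof -
  have f: "((\<lambda>z. fst z) has_derivative fst) (at z)"
    by (intro bounded_linear_imp_has_derivative bounded_linear_fst)
  have G: "((\<lambda>z. g (fst z)) has_derivative (\<lambda>h. g' (fst z) (fst h))) (at z)"
    using has_derivative_compose[OF f g'[OF assms]] .
  have G': "((\<lambda>z. g' (fst z) e) has_derivative (\<lambda>h. g'' (fst z) (fst h) e)) (at z)" for e
    using bounded_linear.has_derivative[OF blinfun.bounded_linear_left
        has_derivative_compose[OF f g''[OF assms]]] .
  have S: "((\<lambda>z. snd z) has_derivative snd) (at z)"
    by (intro bounded_linear_imp_has_derivative bounded_linear_snd)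
  have "(covector_map has_derivative (\<lambda>h. (fst h,
      \<Sum>i\<in>UNIV. (snd z \<bullet> g'' (fst z) (fst h) (axis i 1) + snd h \<bullet> g' (fst z) (axis i 1)) *\<^sub>R axis i (1::real),
      snd z \<bullet> g' (fst z) (fst h) + snd h \<bullet> g (fst z)))) (at z)"
    unfolding covector_map_def[abs_def] frame_values_def
    by (rule has_derivative_Pair[OF f has_derivative_Pair[OF has_derivative_sum[OF
        has_derivative_scaleR_left[OF has_derivative_inner[OF S G']]] has_derivative_inner[OF S G]]])
  then show ?thesis
    by (simp add: covector_map'_def[abs_def] add.commute)
qed

text \<open>The coordinates of the cotangent bundle are defined implicitly, as a solution of linear
equations with coefficients depending on \<open>p\<close>; they are differentiable because their inverse
\<open>covector_map\<close> has an invertible derivative.\<close>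
lemma covector_inverse_differentiable:
  assumes "fst y \<in> V" shows "covector_inverse differentiable (at y)"
proof -
  define z where "z = covector_inverse y"
  have z: "fst z \<in> V" "covector_map z = y"
    using assms by (auto simp: z_def covector_inverse_def covector_map_def frame_values_inv)
  have lin: "linear (covector_map' z)"
    using has_derivative_linear[OF covector_map_has_derivative[OF z(1)]] .
  have "h = 0" if h: "covector_map' z h = 0" for h
  proof -
    have f0: "fst h = 0" using h by (simp add: covector_map'_def prod_eq_iff)
    then have "frame_values (fst z) (snd h) = frame_values (fst z) 0"
      using h by (simp add: covector_map'_def frame_values_def prod_eq_iff)
    then have "snd h = 0" using inj_frame_values[OF z(1)] by (meson injD)
    with f0 show ?thesis by (simp add: prod_eq_iff)
  qed
  then have "inj (covector_map' z)" by (simp add: linear_injective_0[OF lin])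
  then obtain k where k: "covector_map' z \<circ> k = id"
    using linear_inj_imp_surj[OF lin] unfolding surj_iff by blast
  have "continuous_on (V \<times> UNIV) covector_map"
    by (rule has_derivative_continuous_on[OF has_derivative_at_withinI[OF covector_map_has_derivative]]) auto
  then have "(covector_inverse has_derivative k) (at (covector_map z))"
    using has_derivative_inverse_strong[of "V \<times> UNIV" z covector_map covector_inverse "covector_map' z" k]
      open_V z(1) k covector_map_has_derivative[OF z(1)] covector_inverse_covector_map
    by (simp add: open_Times mem_Times_iff)
  then show ?thesis using z(2) by (auto simp: differentiable_def)
qed

definition covector :: "real ^ 'n \<Rightarrow> real ^ 'n \<Rightarrow> (real ^ 'n) \<times> real" where
  "covector p q = snd (covector_inverse (p, (q, 0)))"

lemma covector_tangent: "p \<in> V \<Longrightarrow> covector p q \<bullet> g p = 0"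
  and covector_inner: "p \<in> V \<Longrightarrow> covector p q \<bullet> g' p w = q \<bullet> w"
  using frame_values_inv[of p "(q, 0)"] fst_frame_values_inner[of p "covector p q" w]
  by (auto simp: covector_def covector_inverse_def frame_values_def prod_eq_iff)

lemma covector_unique:
  assumes "p \<in> V" "A \<bullet> g p = 0" "\<And>i. A \<bullet> g' p (axis i (1::real)) = q $ i"
  shows "A = covector p q"
proof -
  have "frame_values p A = (q, 0)"
    using assms by (auto simp: prod_eq_iff vec_eq_iff fst_frame_values) (simp add: frame_values_def)
  also have "\<dots> = frame_values p (covector p q)"
    by (simp add: covector_def covector_inverse_def frame_values_inv[OF assms(1)])
  finally show ?thesis using inj_frame_values[OF assms(1)] by (meson injD)
qed

lemma cotangent_coordinates_eq:
  assumes "p \<in> V"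
  shows "cotangent_coordinates g (p, q) = (g p, blinfun_inner_right (covector p q))"
  unfolding cotangent_coordinates_def prod.case
proof (intro arg_cong2[where f = Pair] refl the_equality)
  fix \<alpha>
  assume \<alpha>: "blinfun_apply \<alpha> (g p) = 0 \<and>
    (\<forall>i. blinfun_apply \<alpha> (frechet_derivative g (at p) (axis i 1)) = q $ i)"
  obtain A where A: "\<alpha> = blinfun_inner_right A" using blinfun_eq_inner_right by blast
  show "\<alpha> = blinfun_inner_right (covector p q)"
    unfolding A using \<alpha> assms
    by (auto simp: A frechet_derivative_chart intro!: arg_cong[where f = blinfun_inner_right] covector_unique)
qed (use assms in \<open>auto simp: frechet_derivative_chart covector_tangent covector_inner inner_axis\<close>)

lemma cotangent_coordinates_differentiable:
  assumes "p \<in> V" shows "cotangent_coordinates g differentiable (at (p, q))"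
proof -
  have "(\<lambda>z. (g (fst z), blinfun_inner_right (covector (fst z) (snd z)))) differentiable (at (p, q))"
  proof -
    have 1: "(\<lambda>z :: (real ^ 'n) \<times> (real ^ 'n). (fst z, snd z, 0::real)) differentiable (at (p, q))"
      by (intro bounded_linear_imp_differentiable bounded_linear_intros)
    have "(\<lambda>z. covector_inverse (fst z, snd z, 0)) differentiable (at (p, q))"
      using differentiable_compose[of covector_inverse, OF _ 1] covector_inverse_differentiable assms by simp
    then have 2: "(\<lambda>z. blinfun_inner_right (covector (fst z) (snd z))) differentiable (at (p, q))"
      unfolding covector_def
      by (rule differentiable_compose[OF bounded_linear_imp_differentiable, rotated])
        (intro bounded_linear_compose[OF bounded_linear_blinfun_inner_right] bounded_linear_snd)
    have "(\<lambda>z. g (fst z)) differentiable (at (p, q))"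
      by (rule differentiable_compose[of g]) (use g'[OF assms] in \<open>auto simp: differentiable_def
          intro: bounded_linear_imp_has_derivative bounded_linear_fst\<close>)
    with 2 show ?thesis by (intro differentiable_Pair)
  qed
  moreover have "open (V \<times> (UNIV :: (real ^ 'n) set))" using open_V by (intro open_Times) auto
  ultimately obtain D where D: "((\<lambda>z. (g (fst z), blinfun_inner_right (covector (fst z) (snd z)))) has_derivative D) (at (p, q))"
    and "open (V \<times> (UNIV :: (real ^ 'n) set))" by (auto simp: differentiable_def)
  from has_derivative_transform_within_open[OF this] have "(cotangent_coordinates g has_derivative D) (at (p, q))"
    using assms by (auto simp: cotangent_coordinates_eq)
  then show ?thesis by (auto simp: differentiable_def)
qed

text \<open>This is \<open>\<Sum>i. dp\<^sub>i \<and> dq\<^sub>i = \<Sum>j. dx\<^sub>j \<and> d\<alpha>\<^sub>j\<close>, where \<open>x\<close> and \<open>\<alpha>\<close> are the ambient coordinates of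
the point and the covector. Both sides are minus the exterior derivative of the tautological
1-form. Differentiating its coordinate expression \<open>\<alpha> (g' p w) = q \<bullet> w\<close> at fixed \<open>w\<close> gives
\<open>sndD\<close>, and the terms with second derivatives of \<open>g\<close> cancel by symmetry.\<close>
lemma canonical_form_in_chart:
  assumes p: "p \<in> V" and D: "(cotangent_coordinates g has_derivative D) (at (p, q))"
  shows "snd (D v) (fst (D u)) - snd (D u) (fst (D v)) = fst u \<bullet> snd v - fst v \<bullet> snd u"
proof -
  have fstD: "fst (D u) = g' p (fst u)" for u
  proof -
    have "((\<lambda>z. fst (cotangent_coordinates g z)) has_derivative (\<lambda>u. fst (D u))) (at (p, q))"
      by (rule has_derivative_fst[OF D])
    moreover have "(\<lambda>z. fst (cotangent_coordinates g z)) = (\<lambda>z. g (fst z))"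
      by (auto simp: cotangent_coordinates_def)
    moreover have "((\<lambda>z. g (fst z)) has_derivative (\<lambda>u. g' p (fst u))) (at (p, q))"
      using has_derivative_compose[OF has_derivative_fst[OF has_derivative_ident], of g "g' p" "(p, q)"] g'[OF p]
      by simp
    ultimately show ?thesis by (metis has_derivative_unique)
  qed
  have sndD: "snd (D u) (g' p w) = snd u \<bullet> w - covector p q \<bullet> g'' p (fst u) w" for u w
  proof -
    have f: "((\<lambda>z. fst z) has_derivative fst) (at (p, q))"
      by (intro bounded_linear_imp_has_derivative bounded_linear_fst)
    have 1: "((\<lambda>z. snd (cotangent_coordinates g z)) has_derivative (\<lambda>u. snd (D u))) (at (p, q))"
      by (rule has_derivative_snd[OF D])
    have "((\<lambda>z. g' (fst z)) has_derivative (\<lambda>u. g'' p (fst u))) (at (p, q))"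
      using has_derivative_compose[OF f, of g' "g'' p"] g''[OF p] by simp
    then have 2: "((\<lambda>z. g' (fst z) w) has_derivative (\<lambda>u. g'' p (fst u) w)) (at (p, q))"
      by (rule bounded_linear.has_derivative[OF blinfun.bounded_linear_left])
    have 3: "((\<lambda>z. snd (cotangent_coordinates g z) (g' (fst z) w)) has_derivative
        (\<lambda>u. covector p q \<bullet> g'' p (fst u) w + snd (D u) (g' p w))) (at (p, q))"
      using blinfun.FDERIV[OF 1 2] by (simp add: cotangent_coordinates_eq[OF p])
    have "((\<lambda>z. snd z \<bullet> w) has_derivative (\<lambda>u. snd u \<bullet> w)) (at (p, q))"
      by (intro bounded_linear_imp_has_derivative bounded_linear_intros)
    then have "((\<lambda>z. snd (cotangent_coordinates g z) (g' (fst z) w)) has_derivative (\<lambda>u. snd u \<bullet> w)) (at (p, q))"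
      by (rule has_derivative_transform_within_open[of _ _ _ _ "V \<times> UNIV"])
        (use open_V p in \<open>auto simp: open_Times cotangent_coordinates_eq covector_inner\<close>)
    from fun_cong[OF has_derivative_unique[OF 3 this], of u] show ?thesis by simp
  qed
  have "g'' p (fst u) (fst v) = g'' p (fst v) (fst u)"
    by (rule second_derivative_symmetric[OF open_V p g' g''[OF p]])
  then show ?thesis by (simp add: fstD sndD inner_commute)
qed

end

lemma local_coordinates_chart:
  assumes "local_coordinates V g"
  obtains g' g'' where "sphere_chart V g g' g''"
proof -
  obtain g' g'' where g: "\<And>x. x \<in> V \<Longrightarrow> (g has_derivative blinfun_apply (g' x)) (at x)"
      "\<And>x. x \<in> V \<Longrightarrow> (g' has_derivative blinfun_apply (g'' x)) (at x)"
    using assms unfolding local_coordinates_def C2_on_def by metis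
  have "sphere_chart V g g' g''"
    using assms g frechet_derivative_at[OF g(1)] unfolding local_coordinates_def
    by unfold_locales auto
  then show thesis by (rule that)
qed

text \<open>The form \<open>\<Sum>j. dx\<^sub>j \<and> d\<alpha>\<^sub>j\<close> of the ambient space makes no reference to a chart and restricts to
\<open>\<Sum>i. dp\<^sub>i \<and> dq\<^sub>i\<close> in every chart.\<close>
lemma omega_0_canonical: "is_canonical_symplectic_form (omega_0 :: (((real ^ 'n) \<times> real) \<times> _, real) form2)"
proof -
  define \<omega> :: "(((real ^ 'n) \<times> real) \<times> (((real ^ 'n) \<times> real) \<Rightarrow>\<^sub>L real), real) form2"
    where "\<omega> = (\<lambda>x u v. blinfun_apply (snd v) (fst u) - blinfun_apply (snd u) (fst v))"
  have "is_canonical_symplectic_form \<omega>"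
    unfolding is_canonical_symplectic_form_def
  proof (intro allI impI ballI)
    fix V :: "(real ^ 'n) set" and g p q and u v :: "(real ^ 'n) \<times> (real ^ 'n)"
    assume "local_coordinates V g" and p: "p \<in> V"
    then obtain g' g'' where "sphere_chart V g g' g''" by (elim local_coordinates_chart)
    then interpret sphere_chart V g g' g'' .
    show "pullback (cotangent_coordinates g) \<omega> (p, q) u v =
        (\<Sum>i\<in>UNIV. fst u $ i * snd v $ i - fst v $ i * snd u $ i)"
      using canonical_form_in_chart[OF p, where q = q and u = u and v = v]
        cotangent_coordinates_differentiable[OF p, of q]
      by (simp add: pullback_def \<omega>_def frechet_derivative_works inner_vec_def sum_subtractf)
  qed
  then show ?thesis unfolding omega_0_def by (rule someI[where P = is_canonical_symplectic_form])
qed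

section \<open>The symplectic form in stereographic coordinates\<close>

text \<open>The factor by which inverse stereographic projection scales lengths at \<open>x\<close>.\<close>
definition conformal_factor :: "'a::real_inner \<Rightarrow> real" where
  "conformal_factor x = 2 / (1 + x \<bullet> x)"

lemma one_plus_inner_pos: "0 < 1 + x \<bullet> (x :: 'a :: real_inner)"
  by (simp add: add_pos_nonneg)

lemma conformal_factor_inner: "conformal_factor x * (x \<bullet> x) = 2 - conformal_factor x"
  using one_plus_inner_pos[of x] by (simp add: conformal_factor_def field_simps)

lemma conformal_factor_pos: "conformal_factor x > 0"
  using one_plus_inner_pos[of x] by (simp add: conformal_factor_def)

lemma stereographic_unique:
  assumes "z \<in> sphere 0 1 - {(0, 1)}" "stereographic z = x"
  shows "z = (conformal_factor x *\<^sub>R x, 1 - conformal_factor x)"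
proof -
  obtain y h where z: "z = (y, h)" by (cases z)
  have yy: "y \<bullet> y + h * h = 1"
    using assms(1) by (simp add: z norm_eq_1)
  have h: "h \<noteq> 1"
    using yy assms(1) by (auto simp: z)
  then have y: "y = (1 - h) *\<^sub>R x"
    using assms(2) by (auto simp: z stereographic_def)
  have "(1 - h) * ((1 - h) * (1 + x \<bullet> x) - 2) = 0"
    using yy unfolding y by (simp add: algebra_simps)
  then have "(1 - h) * (1 + x \<bullet> x) = 2"
    using h by simp
  then have "1 - h = conformal_factor x"
    using one_plus_inner_pos[of x] by (simp add: conformal_factor_def eq_divide_eq)
  then show ?thesis by (simp add: z y)
qed

lemma inverse_stereographic_eq:
  "inverse_stereographic x = (conformal_factor x *\<^sub>R x, 1 - conformal_factor x)" (is "_ = ?z")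
  unfolding inverse_stereographic_def
proof (rule inv_into_f_eq)
  show "inj_on stereographic (sphere 0 1 - {(0, 1)})"
    by (rule inj_onI) (metis stereographic_unique)
  have "?z \<bullet> ?z = conformal_factor x * (conformal_factor x * (x \<bullet> x)) + (1 - conformal_factor x)\<^sup>2"
    by (simp add: power2_eq_square)
  also have "\<dots> = 1"
    unfolding conformal_factor_inner by (simp add: power2_eq_square algebra_simps)
  finally show "?z \<in> sphere 0 1 - {(0, 1)}"
    using conformal_factor_pos[of x] by (auto simp: norm_eq_1)
  show "stereographic ?z = x"
    using conformal_factor_pos[of x] by (simp add: stereographic_def)
qed

lemma norm_inverse_stereographic: "norm (inverse_stereographic x) = 1"
proof -
  have "inverse_stereographic x \<bullet> inverse_stereographic x =
      conformal_factor x * (conformal_factor x * (x \<bullet> x)) + (1 - conformal_factor x)\<^sup>2"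
    by (simp add: inverse_stereographic_eq power2_eq_square)
  also have "\<dots> = 1"
    unfolding conformal_factor_inner by (simp add: power2_eq_square algebra_simps)
  finally show ?thesis by (simp add: norm_eq_1)
qed

lemma has_derivative_conformal_factor [derivative_intros]:
  assumes "(f has_derivative f') (at x within S)"
  shows "((\<lambda>x. conformal_factor (f x)) has_derivative
    (\<lambda>h. - (conformal_factor (f x))\<^sup>2 * (f x \<bullet> f' h))) (at x within S)"
  unfolding conformal_factor_def
  apply (rule has_derivative_eq_rhs)
   apply (rule derivative_intros assms refl)+
  using one_plus_inner_pos[of "f x"] apply simp
  using one_plus_inner_pos[of "f x"]
  by (auto simp: fun_eq_iff field_simps power2_eq_square inner_commute)

lemma continuous_on_conformal_factor [continuous_intros]:
  "continuous_on S f \<Longrightarrow> continuous_on S (\<lambda>x. conformal_factor (f x))"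
  unfolding conformal_factor_def
  by (intro continuous_intros) (auto simp: less_imp_neq[OF one_plus_inner_pos, symmetric])

text \<open>The derivative of inverse stereographic projection, written with operations on bounded linear
maps so that it can be differentiated once more.\<close>
definition stereographic_chart' :: "real ^ 'n \<Rightarrow> (real ^ 'n) \<Rightarrow>\<^sub>L ((real ^ 'n) \<times> real)" where
  "stereographic_chart' x = conformal_factor x *\<^sub>R Blinfun (\<lambda>h. (h, 0)) -
     (conformal_factor x)\<^sup>2 *\<^sub>R (blinfun_scaleR_left (x, - 1) o\<^sub>L blinfun_inner_right x)"

lemma stereographic_chart'_apply:
  fixes x :: "real ^ 'n"
  shows
  "stereographic_chart' x h =
     (conformal_factor x *\<^sub>R h - ((conformal_factor x)\<^sup>2 * (x \<bullet> h)) *\<^sub>R x, (conformal_factor x)\<^sup>2 * (x \<bullet> h))"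
proof -
  have "bounded_linear (\<lambda>h :: real ^ 'n. (h, 0 :: real))"
    by (intro bounded_linear_intros)
  then show ?thesis
    by (simp add: stereographic_chart'_def minus_blinfun.rep_eq scaleR_blinfun.rep_eq
        bounded_linear_Blinfun_apply algebra_simps)
qed

lemma inverse_stereographic_has_derivative:
  "(inverse_stereographic has_derivative stereographic_chart' x) (at x)"
  unfolding inverse_stereographic_eq[abs_def]
  by (auto intro!: derivative_eq_intros simp: stereographic_chart'_apply algebra_simps)

lemma C2_inverse_stereographic: "C2_on (inverse_stereographic :: real ^ 'n \<Rightarrow> _) UNIV"
proof -
  define D :: "real ^ 'n \<Rightarrow> real ^ 'n \<Rightarrow> (real ^ 'n) \<Rightarrow>\<^sub>L ((real ^ 'n) \<times> real)" where
    "D x h = (- (conformal_factor x)\<^sup>2 * (x \<bullet> h)) *\<^sub>R Blinfun (\<lambda>h. (h, 0)) -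
       ((conformal_factor x)\<^sup>2 *\<^sub>R ((blinfun_scaleR_left (x, - 1) o\<^sub>L blinfun_inner_right h) +
          (blinfun_scaleR_left (h, 0) o\<^sub>L blinfun_inner_right x))
        - (2 * conformal_factor x * ((conformal_factor x)\<^sup>2 * (x \<bullet> h))) *\<^sub>R
          (blinfun_scaleR_left (x, - 1) o\<^sub>L blinfun_inner_right x))" for x h
  have D: "(stereographic_chart' has_derivative D x) (at x)" for x
    unfolding stereographic_chart'_def[abs_def] D_def[abs_def]
    by (auto intro!: derivative_eq_intros simp: algebra_simps)
  then have BD: "blinfun_apply (Blinfun (D x)) = D x" for x
    by (intro bounded_linear_Blinfun_apply has_derivative_bounded_linear)
  have "continuous_on UNIV (\<lambda>x. Blinfun (D x))"
    by (rule continuous_on_blinfun_componentwise) (simp only: BD D_def, intro continuous_intros)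
  then show ?thesis
    unfolding C2_on_def
    by (intro exI[of _ stereographic_chart'] exI[of _ "\<lambda>x. Blinfun (D x)"])
      (simp add: BD D inverse_stereographic_has_derivative)
qed

lemma local_coordinates_inverse_stereographic:
  "local_coordinates UNIV (inverse_stereographic :: real ^ 'n \<Rightarrow> _)"
  unfolding local_coordinates_def
proof (intro conjI ballI)
  show "inj inverse_stereographic"
    by (auto simp: inj_def inverse_stereographic_eq less_imp_neq[OF conformal_factor_pos, symmetric])
  fix p :: "real ^ 'n"
  have "h = 0" if "stereographic_chart' p h = 0" for h
    using that conformal_factor_pos[of p] by (auto simp: stereographic_chart'_apply zero_prod_def)
  then have "inj (stereographic_chart' p)"
    by (simp add: linear_injective_0 bounded_linear.linear[OF blinfun.bounded_linear_right])
  then show "inj (frechet_derivative inverse_stereographic (at p))"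
    using frechet_derivative_at[OF inverse_stereographic_has_derivative] by metis
qed (auto simp: C2_inverse_stereographic norm_inverse_stereographic)

lemma sphere_chart_stereographic:
  obtains g'' :: "real ^ 'n \<Rightarrow> (real ^ 'n) \<Rightarrow>\<^sub>L ((real ^ 'n) \<Rightarrow>\<^sub>L ((real ^ 'n) \<times> real))"
  where "sphere_chart UNIV inverse_stereographic stereographic_chart' g''"
proof -
  obtain g' :: "real ^ 'n \<Rightarrow> (real ^ 'n) \<Rightarrow>\<^sub>L ((real ^ 'n) \<times> real)" and g''
    where *: "sphere_chart UNIV inverse_stereographic g' g''"
    by (rule local_coordinates_chart[OF local_coordinates_inverse_stereographic])
  then interpret sphere_chart UNIV inverse_stereographic g' g'' .
  have "g' = stereographic_chart'"
    by (rule ext, rule blinfun_eqI)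
      (metis UNIV_I g' has_derivative_unique inverse_stereographic_has_derivative)
  with * that show thesis by blast
qed

text \<open>The left-hand side is half the squared chordal distance, so this is the formula for the
distortion of distances under stereographic projection.\<close>
lemma inner_inverse_stereographic:
  "1 - inverse_stereographic x \<bullet> inverse_stereographic y =
     conformal_factor x * conformal_factor y * ((x - y) \<bullet> (x - y)) / 2"
proof -
  define F G where "F = conformal_factor x" and "G = conformal_factor y"
  have F: "F * (x \<bullet> x) = 2 - F" and G: "G * (y \<bullet> y) = 2 - G"
    unfolding F_def G_def by (rule conformal_factor_inner)+
  have "F * G * ((x - y) \<bullet> (x - y)) = G * (F * (x \<bullet> x)) + F * (G * (y \<bullet> y)) - 2 * (F * G * (x \<bullet> y))"
    by (simp add: algebra_simps inner_commute)
  then show ?thesis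
    unfolding F G by (simp add: inverse_stereographic_eq F_def[symmetric] G_def[symmetric] algebra_simps)
qed

text \<open>The fibre coordinates of \<open>\<psi>\<^sub>n\<close> in the stereographic chart. By the formula for
\<open>1 - X \<bullet> Y\<close> above, this is the gradient of \<open>- ln (1 - X \<bullet> Y)\<close> with respect to \<open>x\<close>, where \<open>X\<close>
and \<open>Y\<close> are the images of \<open>x\<close> and \<open>y\<close> on the sphere.\<close>
definition stereographic_fibre_coord :: "real ^ 'n \<Rightarrow> real ^ 'n \<Rightarrow> real ^ 'n" where
  "stereographic_fibre_coord x y =
     conformal_factor x *\<^sub>R x - (2 / ((x - y) \<bullet> (x - y))) *\<^sub>R (x - y)"

text \<open>As \<open>X\<close> is orthogonal to the tangent vector \<open>dX w\<close>, the left-hand side is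
\<open>(Y \<bullet> dX w) / (1 - X \<bullet> Y)\<close>.\<close>
lemma stereographic_from_inner_chart':
  assumes "x \<noteq> y"
  shows "stereographic_from (inverse_stereographic x) (inverse_stereographic y) \<bullet> stereographic_chart' x w =
    stereographic_fibre_coord x y \<bullet> w"
proof -
  define F G where "F = conformal_factor x" and "G = conformal_factor y"
  define N where "N = (x - y) \<bullet> (x - y)"
  have F: "F * (x \<bullet> x) = 2 - F" and G: "G * (y \<bullet> y) = 2 - G" and pos: "F > 0" "G > 0"
    unfolding F_def G_def by (rule conformal_factor_inner conformal_factor_pos)+
  have N: "N > 0" using assms by (simp add: N_def)
  have FG: "F * G * N = 2 * (F + G) - 2 * F * G - 2 * F * G * (x \<bullet> y)"
  proof -
    have "F * G * N = G * (F * (x \<bullet> x)) + F * (G * (y \<bullet> y)) - 2 * (F * G * (x \<bullet> y))"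
      by (simp add: N_def algebra_simps inner_commute)
    then show ?thesis unfolding F G by (simp add: algebra_simps)
  qed
  have 1: "inverse_stereographic x \<bullet> stereographic_chart' x w = 0"
  proof -
    have "inverse_stereographic x \<bullet> stereographic_chart' x w =
        F * F * (x \<bullet> w) - (F * F) * (x \<bullet> w) * (F * (x \<bullet> x)) + (1 - F) * (F * F * (x \<bullet> w))"
      by (simp add: inverse_stereographic_eq stereographic_chart'_apply F_def[symmetric] power2_eq_square algebra_simps)
    then show ?thesis unfolding F by (simp add: algebra_simps)
  qed
  have 2: "inverse_stereographic y \<bullet> stereographic_chart' x w =
      F * G * (y \<bullet> w) + F * (x \<bullet> w) * (F - F * G - F * G * (x \<bullet> y))"
    by (simp add: inverse_stereographic_eq stereographic_chart'_apply F_def[symmetric] G_def[symmetric]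
        power2_eq_square algebra_simps inner_commute)
  have 3: "1 - inverse_stereographic x \<bullet> inverse_stereographic y = F * G * N / 2"
    by (simp add: inner_inverse_stereographic F_def G_def N_def)
  have *: "F - F * G - F * G * (x \<bullet> y) = F * G * N / 2 - G"
    using FG by (simp add: algebra_simps)
  define R where "R = F * (x \<bullet> w) - 2 / N * ((x \<bullet> w) - (y \<bullet> w))"
  have "F * G * N / 2 * R = F * G * N / 2 * (F * (x \<bullet> w)) - F * G * ((x \<bullet> w) - (y \<bullet> w))"
    unfolding R_def right_diff_distrib[of "F * G * N / 2"] using N by simp
  then have YR: "inverse_stereographic y \<bullet> stereographic_chart' x w = F * G * N / 2 * R"
    unfolding 2 * by (simp add: algebra_simps)
  have "stereographic_from (inverse_stereographic x) (inverse_stereographic y) \<bullet> stereographic_chart' x w =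
      1 / (F * G * N / 2) * (F * G * N / 2 * R)"
    unfolding stereographic_from_def 3 inner_scaleR_left inner_diff_left 1 YR by simp
  also have "\<dots> = R" using pos N by simp
  finally have "stereographic_from (inverse_stereographic x) (inverse_stereographic y) \<bullet> stereographic_chart' x w = R" .
  then show ?thesis
    by (simp add: R_def stereographic_fibre_coord_def F_def N_def inner_diff_left[of _ _ w])
qed

text \<open>This factorization reduces the pull-back of \<open>\<omega>\<^sub>0\<close> along \<open>\<psi>\<^sub>n\<close> to one along a chart, the only kind
about which the characterization of \<open>\<omega>\<^sub>0\<close> speaks.\<close>
lemma psi_stereographic_pair:
  fixes x y :: "real ^ 'n"
  assumes "x \<noteq> y"
  shows "psi (stereographic_pair (x, y)) =
    cotangent_coordinates inverse_stereographic (x, stereographic_fibre_coord x y)"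
proof -
  obtain g'' :: "real ^ 'n \<Rightarrow> (real ^ 'n) \<Rightarrow>\<^sub>L ((real ^ 'n) \<Rightarrow>\<^sub>L ((real ^ 'n) \<times> real))"
    where "sphere_chart UNIV inverse_stereographic stereographic_chart' g''"
    by (rule sphere_chart_stereographic)
  then interpret sphere_chart UNIV inverse_stereographic stereographic_chart' g'' .
  have "stereographic_from (inverse_stereographic x) (inverse_stereographic y) =
      covector x (stereographic_fibre_coord x y)"
  proof (rule covector_unique)
    show "stereographic_from (inverse_stereographic x) (inverse_stereographic y) \<bullet> inverse_stereographic x = 0"
      using norm_inverse_stereographic[of x]
      by (simp add: stereographic_from_def inner_diff_right inner_commute norm_eq_1)
  qed (simp_all add: stereographic_from_inner_chart'[OF assms] inner_axis)
  then show ?thesis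
    by (simp add: psi_def stereographic_pair_def cotangent_coordinates_eq)
qed

lemma stereographic_fibre_coord_has_derivative:
  assumes "x \<noteq> y"
  shows "((\<lambda>z. stereographic_fibre_coord (fst z) (snd z)) has_derivative
    (\<lambda>h. conformal_factor x *\<^sub>R fst h - ((conformal_factor x)\<^sup>2 * (x \<bullet> fst h)) *\<^sub>R x
       - (2 / ((x - y) \<bullet> (x - y))) *\<^sub>R (fst h - snd h)
       + (4 * ((x - y) \<bullet> (fst h - snd h)) / ((x - y) \<bullet> (x - y))\<^sup>2) *\<^sub>R (x - y))) (at (x, y))"
proof -
  define d where "d = x - y"
  have N: "d \<bullet> d \<noteq> 0" using assms by (simp add: d_def)
  have F: "((\<lambda>z. fst z) has_derivative fst) (at (x, y))"
    by (intro bounded_linear_imp_has_derivative bounded_linear_fst)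
  have D: "((\<lambda>z. fst z - snd z) has_derivative (\<lambda>h. fst h - snd h)) (at (x, y))"
    by (intro bounded_linear_imp_has_derivative bounded_linear_sub bounded_linear_fst bounded_linear_snd)
  have "((\<lambda>z. (fst z - snd z) \<bullet> (fst z - snd z)) has_derivative (\<lambda>h. 2 * (d \<bullet> (fst h - snd h)))) (at (x, y))"
    using has_derivative_inner[OF D D] by (simp add: d_def inner_commute)
  from has_derivative_divide[OF has_derivative_const[of 2] this] N
  have I: "((\<lambda>z. 2 / ((fst z - snd z) \<bullet> (fst z - snd z))) has_derivative
      (\<lambda>h. - (4 * (d \<bullet> (fst h - snd h)) / (d \<bullet> d)\<^sup>2))) (at (x, y))"
    by (simp add: d_def power2_eq_square divide_inverse mult_ac)
  have "((\<lambda>z. conformal_factor (fst z)) has_derivative (\<lambda>h. - (conformal_factor x)\<^sup>2 * (x \<bullet> fst h))) (at (x, y))"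
    using has_derivative_conformal_factor[OF F] by simp
  from has_derivative_diff[OF has_derivative_scaleR[OF this F] has_derivative_scaleR[OF I D]]
  show ?thesis
    unfolding stereographic_fibre_coord_def d_def
    by (rule has_derivative_eq_rhs) (simp add: fun_eq_iff algebra_simps)
qed

lemma stereographic_pair_differentiable: "stereographic_pair differentiable (at z)"
proof -
  have "((\<lambda>z. inverse_stereographic (fst z)) has_derivative (\<lambda>h. stereographic_chart' (fst z) (fst h))) (at z)"
    "((\<lambda>z. inverse_stereographic (snd z)) has_derivative (\<lambda>h. stereographic_chart' (snd z) (snd h))) (at z)"
    by (rule has_derivative_compose[OF _ inverse_stereographic_has_derivative],
        intro bounded_linear_imp_has_derivative bounded_linear_intros)+
  from has_derivative_Pair[OF this] show ?thesis
    by (auto simp: differentiable_def stereographic_pair_def map_prod_def case_prod_beta')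
qed

lemma psi_differentiable:
  assumes "x \<bullet> y \<noteq> 1" shows "psi differentiable (at (x, y))"
proof -
  have "(\<lambda>z. stereographic_from (fst z) (snd z)) differentiable (at (x, y))"
    unfolding stereographic_from_def using assms
    by (intro derivative_intros differentiable_inner bounded_linear_imp_differentiable[OF bounded_linear_fst]
        bounded_linear_imp_differentiable[OF bounded_linear_snd]) auto
  then have "(\<lambda>z. blinfun_inner_right (stereographic_from (fst z) (snd z))) differentiable (at (x, y))"
    by (rule differentiable_compose[OF bounded_linear_imp_differentiable, rotated])
      (rule bounded_linear_blinfun_inner_right)
  then have "(\<lambda>z. (fst z, blinfun_inner_right (stereographic_from (fst z) (snd z)))) differentiable (at (x, y))"
    by (intro differentiable_Pair bounded_linear_imp_differentiable[OF bounded_linear_fst])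
  then show ?thesis
    by (simp add: psi_def case_prod_beta')
qed

text \<open>In the stereographic chart \<open>\<omega>\<^sub>0\<close> pulls back to \<open>\<Sum>i. dx\<^sub>i \<and> dq\<^sub>i\<close>, where \<open>q\<close> is the gradient in \<open>x\<close>
of \<open>- ln |x - y|\<^sup>2\<close> plus a function of \<open>x\<close> alone. The derivative of \<open>q\<close> in \<open>x\<close> is a Hessian, hence
symmetric, and contributes nothing; its derivative in \<open>y\<close> is \<open>- 2\<close> times the mixed derivative
of \<open>ln |x - y|\<close>.\<close>
lemma omega_R_eq:
  fixes x y :: "real ^ 'n"
  assumes "x \<noteq> y"
  shows "omega_R (x, y) u v =
    2 * (mixed_log_hessian x y (fst v) (snd u) - mixed_log_hessian x y (fst u) (snd v))"
proof -
  obtain g'' :: "real ^ 'n \<Rightarrow> (real ^ 'n) \<Rightarrow>\<^sub>L ((real ^ 'n) \<Rightarrow>\<^sub>L ((real ^ 'n) \<times> real))"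
    where "sphere_chart UNIV inverse_stereographic stereographic_chart' g''"
    by (rule sphere_chart_stereographic)
  then interpret sphere_chart UNIV inverse_stereographic stereographic_chart' g'' .
  let ?q = "\<lambda>z :: (real ^ 'n) \<times> (real ^ 'n). stereographic_fibre_coord (fst z) (snd z)"
  let ?Q = "\<lambda>z :: (real ^ 'n) \<times> (real ^ 'n). (fst z, ?q z)"
  define Dq where "Dq h = conformal_factor x *\<^sub>R fst h - ((conformal_factor x)\<^sup>2 * (x \<bullet> fst h)) *\<^sub>R x
       - (2 / ((x - y) \<bullet> (x - y))) *\<^sub>R (fst h - snd h)
       + (4 * ((x - y) \<bullet> (fst h - snd h)) / ((x - y) \<bullet> (x - y))\<^sup>2) *\<^sub>R (x - y)" for h
  define P where "P = frechet_derivative stereographic_pair (at (x, y))"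
  define S where "S = frechet_derivative psi (at (stereographic_pair (x, y)))"
  define C where "C = frechet_derivative (cotangent_coordinates inverse_stereographic) (at (?Q (x, y)))"
  have P: "(stereographic_pair has_derivative P) (at (x, y))"
    unfolding P_def using stereographic_pair_differentiable frechet_derivative_works by blast
  have "inverse_stereographic x \<bullet> inverse_stereographic y \<noteq> 1"
    using inner_inverse_stereographic[of x y] conformal_factor_pos[of x] conformal_factor_pos[of y] assms
    by auto
  then have S: "(psi has_derivative S) (at (stereographic_pair (x, y)))"
    unfolding S_def stereographic_pair_def map_prod_simp
    using psi_differentiable frechet_derivative_works by blast
  have C: "(cotangent_coordinates inverse_stereographic has_derivative C) (at (?Q (x, y)))"
    unfolding C_def using cotangent_coordinates_differentiable frechet_derivative_works by auto
  have Q: "(?Q has_derivative (\<lambda>h. (fst h, Dq h))) (at (x, y))"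
    unfolding Dq_def
    by (rule has_derivative_Pair[OF has_derivative_fst[OF has_derivative_ident]
          stereographic_fibre_coord_has_derivative[OF assms]])
  have "((\<lambda>z. psi (stereographic_pair z)) has_derivative (\<lambda>h. C (fst h, Dq h))) (at (x, y))"
  proof (rule has_derivative_transform_within_open)
    show "((\<lambda>z. cotangent_coordinates inverse_stereographic (?Q z)) has_derivative (\<lambda>h. C (fst h, Dq h))) (at (x, y))"
      by (rule has_derivative_compose[OF Q C])
    show "open {z :: (real ^ 'n) \<times> (real ^ 'n). fst z \<noteq> snd z}"
      by (intro open_Collect_neq continuous_intros)
  qed (use assms in \<open>auto simp: psi_stereographic_pair split: prod.splits\<close>)
  then have SP: "S (P h) = C (fst h, Dq h)" for h
    by (rule fun_cong[OF has_derivative_unique[OF has_derivative_compose[OF P S]]])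
  have "omega_R (x, y) u v = pullback (cotangent_coordinates inverse_stereographic) omega_0
      (?Q (x, y)) (fst u, Dq u) (fst v, Dq v)"
    using psi_stereographic_pair[OF assms]
    by (simp add: omega_R_def pullback_def P_def[symmetric] S_def[symmetric] SP C_def)
  also have "\<dots> = fst u \<bullet> Dq v - fst v \<bullet> Dq u"
    by (simp add: inner_vec_def sum_subtractf omega_0_canonical[unfolded is_canonical_symplectic_form_def,
        rule_format, OF local_coordinates_inverse_stereographic, OF UNIV_I])
  also have "\<dots> = 2 * (mixed_log_hessian x y (fst v) (snd u) - mixed_log_hessian x y (fst u) (snd v))"
  proof -
    define d where "d = x - y"
    have "d \<bullet> d \<noteq> 0" using assms by (simp add: d_def)
    then show ?thesis
      unfolding Dq_def mixed_log_hessian_def d_def[symmetric]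
      by (simp add: algebra_simps add_divide_distrib diff_divide_distrib inner_commute)
  qed
  finally show ?thesis .
qed

section \<open>Conformal transformations on the light cone\<close>

text \<open>Conformal transformations become linear on the light cone of \<open>\<real>\<^sup>3 \<times> \<real> \<times> \<real>\<close>: a point \<open>x\<close> is
represented by the null vector \<open>(x, x \<bullet> x, 1)\<close> and infinity by \<open>(0, 1, 0)\<close>, both up to a
positive factor. This treats points that pass through infinity in an intermediate step of a
composition on the same footing as all others.\<close>
type_synonym lightcone_vector = "(real ^ 3) \<times> real \<times> real"

definition lorentz :: "lightcone_vector \<Rightarrow> lightcone_vector \<Rightarrow> real" where
  "lorentz X Y = fst X \<bullet> fst Y - (fst (snd X) * snd (snd Y) + snd (snd X) * fst (snd Y)) / 2"

fun lightcone_point :: "(real ^ 3) option \<Rightarrow> lightcone_vector" where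
  "lightcone_point None = (0, 1, 0)"
| "lightcone_point (Some x) = (x, x \<bullet> x, 1)"

text \<open>The derivative of \<open>lightcone_point (Some x)\<close> in the direction \<open>h\<close>.\<close>
definition lightcone_tangent :: "real ^ 3 \<Rightarrow> real ^ 3 \<Rightarrow> lightcone_vector" where
  "lightcone_tangent x h = (h, 2 * (x \<bullet> h), 0)"

definition lorentz_lift ::
    "(lightcone_vector \<Rightarrow> lightcone_vector) \<Rightarrow> ((real ^ 3) option \<Rightarrow> (real ^ 3) option) \<Rightarrow> bool" where
  "lorentz_lift M T \<longleftrightarrow> linear M \<and> (\<forall>X Y. lorentz (M X) (M Y) = lorentz X Y) \<and>
     (\<forall>p. \<exists>k>0. M (lightcone_point p) = k *\<^sub>R lightcone_point (T p))"

lemma lorentz_simps: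
  "lorentz (X + Y) Z = lorentz X Z + lorentz Y Z"
  "lorentz Z (X + Y) = lorentz Z X + lorentz Z Y"
  "lorentz (k *\<^sub>R X) Z = k * lorentz X Z"
  "lorentz Z (k *\<^sub>R X) = k * lorentz Z X"
  by (simp_all add: lorentz_def inner_add_left inner_add_right add_divide_distrib algebra_simps)

text \<open>All ingredients of \<open>mixed_log_hessian\<close> are Lorentz products of points and tangents of the light
cone; this is what makes it conformally invariant.\<close>
lemma lorentz_point_point:
  "lorentz (lightcone_point (Some x)) (lightcone_point (Some y)) = - ((x - y) \<bullet> (x - y)) / 2"
  by (simp add: lorentz_def inner_diff_left inner_diff_right inner_commute field_simps)

lemma lorentz_tangent_point:
  "lorentz (lightcone_tangent x a) (lightcone_point (Some y)) = - ((x - y) \<bullet> a)"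
  "lorentz (lightcone_point (Some x)) (lightcone_tangent y b) = (x - y) \<bullet> b"
  by (simp_all add: lorentz_def lightcone_tangent_def inner_diff_left inner_diff_right inner_commute)

lemma lorentz_tangent_tangent:
  "lorentz (lightcone_tangent x a) (lightcone_tangent y b) = a \<bullet> b"
  by (simp add: lorentz_def lightcone_tangent_def)

lemma lorentz_lift_compose:
  assumes "lorentz_lift M T" "lorentz_lift M' T'"
  shows "lorentz_lift (M' \<circ> M) (T' \<circ> T)"
  unfolding lorentz_lift_def
proof (intro conjI allI)
  show "linear (M' \<circ> M)" using assms linear_compose unfolding lorentz_lift_def by blast
  fix p
  obtain k where k: "k > 0" "M (lightcone_point p) = k *\<^sub>R lightcone_point (T p)"
    using assms(1) unfolding lorentz_lift_def by blast
  obtain k' where k': "k' > 0" "M' (lightcone_point (T p)) = k' *\<^sub>R lightcone_point (T' (T p))"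
    using assms(2) unfolding lorentz_lift_def by blast
  have "linear M'" using assms(2) unfolding lorentz_lift_def by blast
  then have "(M' \<circ> M) (lightcone_point p) = (k * k') *\<^sub>R lightcone_point ((T' \<circ> T) p)"
    by (simp add: k k' linear_scale)
  then show "\<exists>k>0. (M' \<circ> M) (lightcone_point p) = k *\<^sub>R lightcone_point ((T' \<circ> T) p)"
    using k k' by (intro exI[of _ "k * k'"]) simp
  show "lorentz ((M' \<circ> M) X) ((M' \<circ> M) Y) = lorentz X Y" for X Y
    using assms unfolding lorentz_lift_def o_apply by metis
qed

definition translation_lift :: "real ^ 3 \<Rightarrow> lightcone_vector \<Rightarrow> lightcone_vector" where
  "translation_lift c X = (fst X + snd (snd X) *\<^sub>R c,
     fst (snd X) + 2 * (fst X \<bullet> c) + snd (snd X) * (c \<bullet> c), snd (snd X))"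

lemma lorentz_lift_translation: "lorentz_lift (translation_lift c) (map_option (\<lambda>x. x + c))"
  unfolding lorentz_lift_def
proof (intro conjI allI)
  show "linear (translation_lift c)"
    by (rule linearI) (simp_all add: translation_lift_def inner_add_left algebra_simps)
  show "lorentz (translation_lift c X) (translation_lift c Y) = lorentz X Y" for X Y
    by (simp add: translation_lift_def lorentz_def inner_add_left inner_add_right inner_commute field_simps)
  show "\<exists>k>0. translation_lift c (lightcone_point p) = k *\<^sub>R lightcone_point (map_option (\<lambda>x. x + c) p)" for p
    by (intro exI[of _ 1], cases p)
      (simp_all add: translation_lift_def inner_add_left inner_add_right inner_commute)
qed

text \<open>Up to scaling, inversion in a sphere around the origin exchanges the last two coordinates.\<close>
lemma lorentz_lift_inversion_0:
  assumes "r > 0"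
  shows "lorentz_lift (\<lambda>X. (fst X, r\<^sup>2 * snd (snd X), fst (snd X) / r\<^sup>2)) (inversion 0 r)" (is "lorentz_lift ?M _")
  unfolding lorentz_lift_def
proof (intro conjI allI)
  show "linear ?M"
    by (rule linearI) (simp_all add: algebra_simps add_divide_distrib)
  show "lorentz (?M X) (?M Y) = lorentz X Y" for X Y
    using assms by (simp add: lorentz_def algebra_simps)
  show "\<exists>k>0. ?M (lightcone_point p) = k *\<^sub>R lightcone_point (inversion 0 r p)" for p
  proof (cases p)
    case None
    then show ?thesis using assms by (intro exI[of _ "1 / r\<^sup>2"]) (simp add: inversion_def)
  next
    case (Some x)
    show ?thesis
    proof (cases "x = 0")
      case True
      then show ?thesis using assms Some by (intro exI[of _ "r\<^sup>2"]) (simp add: inversion_def)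
    next
      case False
      then show ?thesis using assms Some
        by (intro exI[of _ "x \<bullet> x / r\<^sup>2"])
          (simp add: inversion_def power2_norm_eq_inner, simp add: power2_eq_square power4_eq_xxxx)
    qed
  qed
qed

lemma inversion_translate:
  "inversion c r = map_option (\<lambda>x. x + c) \<circ> inversion 0 r \<circ> map_option (\<lambda>x. x + - c)"
  by (auto simp: inversion_def fun_eq_iff split: option.splits)

lemma lorentz_lift_inversion: "r > 0 \<Longrightarrow> \<exists>M. lorentz_lift M (inversion c r)"
  unfolding inversion_translate[of c]
  by (rule exI, rule lorentz_lift_compose, rule lorentz_lift_translation, rule lorentz_lift_compose,
      rule lorentz_lift_inversion_0, assumption, rule lorentz_lift_translation)

definition mirror :: "'a::real_inner \<Rightarrow> 'a \<Rightarrow> 'a" where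
  "mirror n x = x - (2 * (n \<bullet> x) / (n \<bullet> n)) *\<^sub>R n"

lemma linear_mirror: "linear (mirror n)"
  by (rule linearI) (simp_all add: mirror_def inner_add_right add_divide_distrib algebra_simps)

lemma mirror_zero [simp]: "mirror n 0 = 0"
  by (simp add: mirror_def)

lemma inner_mirror: "n \<noteq> 0 \<Longrightarrow> mirror n x \<bullet> mirror n y = x \<bullet> y"
  by (simp add: mirror_def inner_diff_left inner_diff_right inner_commute)

lemma plane_reflection_mirror:
  "plane_reflection n d = map_option (\<lambda>x. x + (2 * d / (n \<bullet> n)) *\<^sub>R n) \<circ> map_option (mirror n)"
  by (auto simp: plane_reflection_def mirror_def fun_eq_iff option.map_comp o_def algebra_simps diff_divide_distrib
      intro!: map_option_cong)

lemma lorentz_lift_plane_reflection: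
  assumes "n \<noteq> 0" shows "\<exists>M. lorentz_lift M (plane_reflection n d)"
proof -
  have "lorentz_lift (\<lambda>X. (mirror n (fst X), snd X)) (map_option (mirror n))"
    unfolding lorentz_lift_def
  proof (intro conjI allI)
    show "linear (\<lambda>X :: lightcone_vector. (mirror n (fst X), snd X))"
      by (rule linearI) (simp_all add: linear_add[OF linear_mirror] linear_scale[OF linear_mirror])
    show "\<exists>k>0. (mirror n (fst (lightcone_point p)), snd (lightcone_point p)) =
        k *\<^sub>R lightcone_point (map_option (mirror n) p)" for p
      by (intro exI[of _ 1], cases p) (simp_all add: inner_mirror[OF assms])
  qed (simp add: lorentz_def inner_mirror[OF assms])
  then show ?thesis
    unfolding plane_reflection_mirror using lorentz_lift_compose[OF _ lorentz_lift_translation] by blast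
qed

lemma conformal_transformation_lorentz_lift:
  "conformal_transformation T \<Longrightarrow> \<exists>M. lorentz_lift M T"
proof (induction rule: conformal_transformation.induct)
  case identity
  have "lorentz_lift id id"
    unfolding lorentz_lift_def
    by (intro conjI allI linear_id[folded id_def] exI[of _ "1 :: real"]) simp_all
  then show ?case by blast
next
  case (inversion T r c)
  then show ?case using lorentz_lift_compose lorentz_lift_inversion[of r c] by blast
next
  case (reflection T n d)
  then show ?case using lorentz_lift_compose lorentz_lift_plane_reflection[of n d] by blast
qed

text \<open>The image of a point is finite precisely if the last coordinate of its lift is positive, which
is an open condition.\<close>
lemma lorentz_lift_eventually_finite:
  assumes M: "lorentz_lift M T" and x: "T (Some x) \<noteq> None"
  shows "\<forall>\<^sub>F z in at x. T (Some z) \<noteq> None"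
proof -
  have lin: "linear M" and pt: "\<And>p. \<exists>k>0. M (lightcone_point p) = k *\<^sub>R lightcone_point (T p)"
    using M unfolding lorentz_lift_def by blast+
  define q where "q z = snd (snd (M (lightcone_point (Some z))))" for z
  have q: "q z > 0 \<longleftrightarrow> T (Some z) \<noteq> None" for z
    using pt[of "Some z"] by (cases "T (Some z)") (auto simp: q_def)
  have "isCont (\<lambda>z. lightcone_point (Some z)) x"
    unfolding lightcone_point.simps by (intro continuous_intros)
  then have "isCont q x"
    unfolding q_def
    by (intro continuous_intros bounded_linear.isCont[OF lin[unfolded linear_conv_bounded_linear]])
  then have "\<forall>\<^sub>F z in at x. 0 < q z"
    using x q[of x] unfolding isCont_def by (intro order_tendstoD(1)[of _ "q x"]) auto
  then show ?thesis by (simp add: q)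
qed

text \<open>Away from preimages of infinity \<open>T\<close> is the linear map \<open>M\<close> followed by normalizing the last
coordinate. So \<open>T\<close> is differentiable, and \<open>M\<close> maps tangents of the light cone to multiples of
the images of these tangents, up to a multiple \<open>\<kappa> h\<close> of the point itself that comes from
differentiating the normalizing factor.\<close>
lemma lorentz_lift_finite_part:
  assumes M: "lorentz_lift M T" and x: "T (Some x) = Some x'"
  obtains k D \<kappa> where "k > 0" "M (lightcone_point (Some x)) = k *\<^sub>R lightcone_point (Some x')"
    "(finite_part T has_derivative D) (at x)"
    "\<And>h. M (lightcone_tangent x h) = \<kappa> h *\<^sub>R lightcone_point (Some x') + k *\<^sub>R lightcone_tangent x' (D h)"
proof -
  have lin: "linear M" and iso: "\<And>X Y. lorentz (M X) (M Y) = lorentz X Y"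
    and pt: "\<And>p. \<exists>k>0. M (lightcone_point p) = k *\<^sub>R lightcone_point (T p)"
    using M unfolding lorentz_lift_def by blast+
  obtain k where k: "k > 0" "M (lightcone_point (Some x)) = k *\<^sub>R lightcone_point (Some x')"
    using pt[of "Some x"] x by auto
  define N where "N z = M (lightcone_point (Some z))" for z
  have "((\<lambda>z. lightcone_point (Some z)) has_derivative lightcone_tangent x) (at x)"
    unfolding lightcone_tangent_def[abs_def]
    by (auto intro!: derivative_eq_intros simp: inner_commute)
  then have N: "(N has_derivative (\<lambda>h. M (lightcone_tangent x h))) (at x)"
    unfolding N_def[abs_def]
    by (rule bounded_linear.has_derivative[OF lin[unfolded linear_conv_bounded_linear]])
  have Nx: "N x = k *\<^sub>R lightcone_point (Some x')" unfolding N_def by (rule k(2))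
  define F where "F z = (1 / snd (snd (N z))) *\<^sub>R fst (N z)" for z
  define \<kappa> where "\<kappa> h = snd (snd (M (lightcone_tangent x h)))" for h
  define D where "D h = (1 / k) *\<^sub>R (fst (M (lightcone_tangent x h)) - \<kappa> h *\<^sub>R x')" for h
  have F: "(F has_derivative D) (at x)"
  proof -
    have q: "((\<lambda>z. snd (snd (N z))) has_derivative \<kappa>) (at x)"
      unfolding \<kappa>_def[abs_def] by (intro has_derivative_snd N)
    have v: "((\<lambda>z. fst (N z)) has_derivative (\<lambda>h. fst (M (lightcone_tangent x h)))) (at x)"
      by (intro has_derivative_fst N)
    have "((\<lambda>z. 1 / snd (snd (N z))) has_derivative (\<lambda>h. - (\<kappa> h / k\<^sup>2))) (at x)"
      using has_derivative_divide[OF has_derivative_const[of 1] q] k(1)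
      by (simp add: Nx power2_eq_square divide_inverse mult_ac)
    from has_derivative_scaleR[OF this v] show ?thesis
      unfolding F_def D_def[abs_def]
      by (rule has_derivative_eq_rhs) (use k(1) in \<open>simp add: Nx fun_eq_iff algebra_simps power2_eq_square\<close>)
  qed
  have "\<forall>\<^sub>F z in at x. T (Some z) \<noteq> None"
    using lorentz_lift_eventually_finite[OF M] x by simp
  then have "\<forall>\<^sub>F z in at x. F z = finite_part T z"
  proof eventually_elim
    case (elim z)
    obtain l where l: "l > 0" "N z = l *\<^sub>R lightcone_point (T (Some z))"
      using pt[of "Some z"] unfolding N_def by blast
    with elim show ?case
      by (cases "T (Some z)") (auto simp: F_def finite_part_def)
  qed
  moreover have "F x = finite_part T x"
    using k(1) by (simp add: F_def Nx finite_part_def x)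
  ultimately have D: "(finite_part T has_derivative D) (at x)"
    using has_derivative_transform_eventually[OF F] by simp
  have "M (lightcone_tangent x h) = \<kappa> h *\<^sub>R lightcone_point (Some x') + k *\<^sub>R lightcone_tangent x' (D h)" for h
  proof -
    have v: "fst (M (lightcone_tangent x h)) = \<kappa> h *\<^sub>R x' + k *\<^sub>R D h"
      using k(1) by (simp add: D_def)
    \<comment> \<open>The definitions of \<open>D\<close> and \<open>\<kappa>\<close> settle the outer coordinates; the middle one follows because
tangents of the light cone are orthogonal to the point.\<close>
    have "lorentz (M (lightcone_point (Some x))) (M (lightcone_tangent x h)) = 0"
      by (simp add: iso lorentz_tangent_point del: lightcone_point.simps)
    then have "k * (x' \<bullet> fst (M (lightcone_tangent x h)) -
        (x' \<bullet> x' * \<kappa> h + fst (snd (M (lightcone_tangent x h)))) / 2) = 0"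
      unfolding k(2) by (simp add: lorentz_def \<kappa>_def algebra_simps)
    then have "x' \<bullet> fst (M (lightcone_tangent x h)) -
        (x' \<bullet> x' * \<kappa> h + fst (snd (M (lightcone_tangent x h)))) / 2 = 0"
      using k(1) by simp
    then have "fst (snd (M (lightcone_tangent x h))) = \<kappa> h * (x' \<bullet> x') + k * (2 * (x' \<bullet> D h))"
      unfolding v by (simp add: inner_add_right field_simps)
    with v show ?thesis
      by (simp add: prod_eq_iff lightcone_tangent_def \<kappa>_def)
  qed
  with k D show thesis by (intro that)
qed

lemma conformal_differentiable:
  assumes "conformal_transformation T" "T (Some x) \<noteq> None"
  shows "(finite_part T has_derivative frechet_derivative (finite_part T) (at x)) (at x)"
proof -
  obtain M where M: "lorentz_lift M T"
    using conformal_transformation_lorentz_lift[OF assms(1)] by blast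
  obtain x' where x': "T (Some x) = Some x'" using assms(2) by blast
  obtain D where D: "(finite_part T has_derivative D) (at x)"
    by (rule lorentz_lift_finite_part[OF M x'])
  then show ?thesis using frechet_derivative_at[OF D] by simp
qed

lemma conformal_eventually_finite:
  assumes "conformal_transformation T" "T (Some x) \<noteq> None"
  shows "\<forall>\<^sub>F z in at x. T (Some z) \<noteq> None"
  using conformal_transformation_lorentz_lift[OF assms(1)] assms(2) lorentz_lift_eventually_finite by blast

text \<open>The numerator is a \<open>2 \<times> 2\<close> determinant. Hence adding a multiple of the point to its tangent has
no effect, and rescaling point and tangent together only scales numerator and denominator by
the same factor.\<close>
lemma mixed_log_hessian_lorentz:
  "mixed_log_hessian x y a b =
    (lorentz (lightcone_tangent x a) (lightcone_tangent y b) * lorentz (lightcone_point (Some x)) (lightcone_point (Some y))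
     - lorentz (lightcone_tangent x a) (lightcone_point (Some y)) * lorentz (lightcone_point (Some x)) (lightcone_tangent y b))
    / (2 * (lorentz (lightcone_point (Some x)) (lightcone_point (Some y)))\<^sup>2)"
proof -
  define N where "N = (x - y) \<bullet> (x - y)"
  show ?thesis
    unfolding mixed_log_hessian_def lorentz_point_point lorentz_tangent_point lorentz_tangent_tangent N_def[symmetric]
    by (cases "N = 0") (simp_all add: field_simps power2_eq_square)
qed

text \<open>The lift preserves the Lorentz form and maps each pair of a point and a tangent to a multiple
of the image pair, up to adding a multiple of the point to the tangent; the expression of
\<open>mixed_log_hessian\<close> by Lorentz products does not notice either change.\<close>
lemma mixed_log_hessian_conformal:
  assumes "conformal_transformation T" "T (Some x) \<noteq> None" "T (Some y) \<noteq> None"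
  shows "mixed_log_hessian (finite_part T x) (finite_part T y)
      (frechet_derivative (finite_part T) (at x) a) (frechet_derivative (finite_part T) (at y) b) =
    mixed_log_hessian x y a b"
proof -
  obtain M where M: "lorentz_lift M T"
    using conformal_transformation_lorentz_lift[OF assms(1)] by blast
  then have iso: "lorentz (M X) (M Y) = lorentz X Y" for X Y unfolding lorentz_lift_def by blast
  obtain x' y' where xy: "T (Some x) = Some x'" "T (Some y) = Some y'" using assms by auto
  obtain k D \<kappa> where k: "k > 0" "M (lightcone_point (Some x)) = k *\<^sub>R lightcone_point (Some x')"
    "(finite_part T has_derivative D) (at x)"
    "\<And>h. M (lightcone_tangent x h) = \<kappa> h *\<^sub>R lightcone_point (Some x') + k *\<^sub>R lightcone_tangent x' (D h)"
    by (rule lorentz_lift_finite_part[OF M xy(1)]) (rule that)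
  obtain l E \<mu> where l: "l > 0" "M (lightcone_point (Some y)) = l *\<^sub>R lightcone_point (Some y')"
    "(finite_part T has_derivative E) (at y)"
    "\<And>h. M (lightcone_tangent y h) = \<mu> h *\<^sub>R lightcone_point (Some y') + l *\<^sub>R lightcone_tangent y' (E h)"
    by (rule lorentz_lift_finite_part[OF M xy(2)]) (rule that)
  let ?X = "lightcone_point (Some x')" and ?Y = "lightcone_point (Some y')"
  let ?A = "lightcone_tangent x' (D a)" and ?B = "lightcone_tangent y' (E b)"
  have B: "lorentz (lightcone_point (Some x)) (lightcone_point (Some y)) = (k * l) * lorentz ?X ?Y"
    using iso[of "lightcone_point (Some x)" "lightcone_point (Some y)"] by (simp only: k l lorentz_simps mult.assoc mult.left_commute distrib_left)
  have BA: "lorentz (lightcone_tangent x a) (lightcone_point (Some y)) = l * (\<kappa> a * lorentz ?X ?Y + k * lorentz ?A ?Y)"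
    using iso[of "lightcone_tangent x a" "lightcone_point (Some y)"] by (simp only: k l lorentz_simps)
  have BB: "lorentz (lightcone_point (Some x)) (lightcone_tangent y b) = \<mu> b * (k * lorentz ?X ?Y) + l * (k * lorentz ?X ?B)"
    using iso[of "lightcone_point (Some x)" "lightcone_tangent y b"] by (simp only: k l lorentz_simps)
  have BAB: "lorentz (lightcone_tangent x a) (lightcone_tangent y b) =
      \<mu> b * (\<kappa> a * lorentz ?X ?Y + k * lorentz ?A ?Y) + l * (\<kappa> a * lorentz ?X ?B + k * lorentz ?A ?B)"
    using iso[of "lightcone_tangent x a" "lightcone_tangent y b"] by (simp only: k l lorentz_simps)
  have "mixed_log_hessian x y a b =
      ((k * l)\<^sup>2 * (lorentz ?A ?B * lorentz ?X ?Y - lorentz ?A ?Y * lorentz ?X ?B)) / ((k * l)\<^sup>2 * (2 * (lorentz ?X ?Y)\<^sup>2))"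
    unfolding mixed_log_hessian_lorentz B BA BB BAB
    by (intro arg_cong2[where f = "(/)"]) (simp_all add: power2_eq_square algebra_simps)
  also have "\<dots> = mixed_log_hessian x' y' (D a) (E b)"
    unfolding mixed_log_hessian_lorentz using k(1) l(1)
    by (intro mult_divide_mult_cancel_left) simp
  finally show ?thesis
    using frechet_derivative_at[OF k(3)] frechet_derivative_at[OF l(3)] by (simp add: finite_part_def xy)
qed

section \<open>The real part of the cross-ratio form\<close>

text \<open>\<open>1 / (w - z)\<^sup>2\<close> is the derivative of \<open>log (w - z)\<close> in \<open>w\<close> and \<open>z\<close>, and the real part of the
logarithm is \<open>ln |w - z|\<close>.\<close>
lemma Re_cross_ratio_mixed_log_hessian:
  assumes "w $ 3 = 0" "z $ 3 = 0" "a $ 3 = 0" "b $ 3 = 0"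
  shows "Re (plane_coord a * plane_coord b / (plane_coord w - plane_coord z)\<^sup>2) = mixed_log_hessian w z a b"
proof -
  define d where "d = w - z"
  have d: "plane_coord w - plane_coord z = plane_coord d" "d $ 3 = 0"
    using assms by (simp_all add: plane_coord_def d_def complex_eq_iff)
  define N where "N = (d $ 1)\<^sup>2 + (d $ 2)\<^sup>2"
  have inner: "x \<bullet> y = x $ 1 * y $ 1 + x $ 2 * y $ 2" if "y $ 3 = 0" for x y :: "real ^ 3"
    using that by (simp add: inner_vec_def sum_3)
  have dd: "d \<bullet> d = N" by (simp add: inner d N_def power2_eq_square)
  have den: "(Re ((plane_coord d)\<^sup>2))\<^sup>2 + (Im ((plane_coord d)\<^sup>2))\<^sup>2 = N\<^sup>2"
    unfolding power2_eq_square N_def plane_coord_def by (simp add: algebra_simps)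
  have num: "Re (plane_coord a * plane_coord b) * Re ((plane_coord d)\<^sup>2) +
      Im (plane_coord a * plane_coord b) * Im ((plane_coord d)\<^sup>2) =
      2 * (d \<bullet> a) * (d \<bullet> b) - (a \<bullet> b) * N"
    unfolding power2_eq_square N_def plane_coord_def by (simp add: inner assms algebra_simps)
  show ?thesis
    unfolding d(1) mixed_log_hessian_def d_def[symmetric] Re_divide den num dd
    by (simp add: diff_divide_distrib power2_eq_square)
qed

lemma sphere_normal_nonzero: "valid_sphere S \<Longrightarrow> Some x \<in> sphere_points S \<Longrightarrow> sphere_normal S x \<noteq> 0"
  by (cases S) (auto simp: dist_norm)

lemma maps_horizontal_point:
  assumes "maps_oriented_sphere T S horizontal_plane" "Some x \<in> sphere_points S" "T (Some x) \<noteq> None"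
  shows "finite_part T x $ 3 = 0"
proof -
  have "T (Some x) \<in> sphere_points horizontal_plane"
    using assms unfolding maps_oriented_sphere_def by blast
  then show ?thesis
    using assms(3) by (auto simp: horizontal_plane_def finite_part_def inner_axis')
qed

text \<open>Preservation of orientation speaks only about tangent bases, so \<open>a\<close> is completed to a positive
one by \<open>n \<times> a\<close>, where \<open>n\<close> is the normal.\<close>
lemma maps_horizontal_tangent:
  assumes S: "valid_sphere S" and T: "maps_oriented_sphere T S horizontal_plane" "conformal_transformation T"
    and x: "Some x \<in> sphere_points S" "T (Some x) \<noteq> None" and a: "sphere_normal S x \<bullet> a = 0"
  shows "frechet_derivative (finite_part T) (at x) a $ 3 = 0"
proof (cases "a = 0")
  case True
  then show ?thesis
    using has_derivative_linear[OF conformal_differentiable[OF T(2) x(2)]] by (simp add: linear_0)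
next
  case False
  define n where "n = sphere_normal S x"
  have n: "n \<noteq> 0" using sphere_normal_nonzero[OF S x(1)] by (simp add: n_def)
  have "positive_basis_at S x a (cross3 n a)"
    using False n a unfolding positive_basis_at_def n_def[symmetric]
    by (simp add: Lagrange dot_cross_self inner_diff_right inner_commute)
  then have "positive_basis_at horizontal_plane (finite_part T x)
      (frechet_derivative (finite_part T) (at x) a) (frechet_derivative (finite_part T) (at x) (cross3 n a))"
    using T(1) x unfolding maps_oriented_sphere_def by blast
  then show ?thesis by (simp add: positive_basis_at_def horizontal_plane_def inner_axis')
qed

lemma knot_pair_has_derivative:
  assumes "(f has_vector_derivative a) (at s)" "(f has_vector_derivative b) (at t)"
  shows "(knot_pair f has_derivative (\<lambda>h. (fst h *\<^sub>R a, snd h *\<^sub>R b))) (at (s, t))"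
proof -
  have "((\<lambda>z. f (fst z)) has_derivative (\<lambda>h. fst h *\<^sub>R a)) (at (s, t))"
    "((\<lambda>z. f (snd z)) has_derivative (\<lambda>h. snd h *\<^sub>R b)) (at (s, t))"
    using has_derivative_compose[OF has_derivative_fst[OF has_derivative_ident], of f "\<lambda>k. k *\<^sub>R a" "(s, t)"]
      has_derivative_compose[OF has_derivative_snd[OF has_derivative_ident], of f "\<lambda>k. k *\<^sub>R b" "(s, t)"] assms
    by (simp_all add: has_vector_derivative_def)
  from has_derivative_Pair[OF this] show ?thesis
    by (simp add: knot_pair_def map_prod_def case_prod_beta')
qed

lemma map_prod_has_derivative:
  assumes "(F has_derivative A) (at x)" "(F has_derivative B) (at y)"
  shows "(map_prod F F has_derivative map_prod A B) (at (x, y))"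
proof -
  have "((\<lambda>z. F (fst z)) has_derivative (\<lambda>h. A (fst h))) (at (x, y))"
    "((\<lambda>z. F (snd z)) has_derivative (\<lambda>h. B (snd h))) (at (x, y))"
    using has_derivative_compose[OF has_derivative_fst[OF has_derivative_ident], of F A "(x, y)"]
      has_derivative_compose[OF has_derivative_snd[OF has_derivative_ident], of F B "(x, y)"] assms
    by simp_all
  from has_derivative_Pair[OF this] show ?thesis
    by (simp add: map_prod_def case_prod_beta')
qed

text \<open>The transformation moves both points and both tangents into the horizontal plane, where the
real part of the form is the mixed derivative; conformal invariance carries it back to the knot.
In particular the real part is the same for every admissible sphere and transformation.\<close>
lemma Re_pullback_cross_ratio_form:
  assumes f: "(f has_vector_derivative a) (at s)" "(f has_vector_derivative b) (at t)"
    and T: "cross_ratio_transformation f s t S T"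
  shows "Re (pullback (knot_pair f) (pullback (map_prod (finite_part T) (finite_part T)) cross_ratio_form) (s, t) u v) =
    ds_dt (s, t) u v * mixed_log_hessian (f s) (f t) a b"
proof -
  have S: "valid_sphere S" "maps_oriented_sphere T S horizontal_plane" "conformal_transformation T"
    and pts: "Some (f s) \<in> sphere_points S" "Some (f t) \<in> sphere_points S"
      "T (Some (f s)) \<noteq> None" "T (Some (f t)) \<noteq> None"
    and nrm: "sphere_normal S (f s) \<bullet> a = 0" "sphere_normal S (f t) \<bullet> b = 0"
    using T vector_derivative_at[OF f(1)] vector_derivative_at[OF f(2)]
    unfolding cross_ratio_transformation_def twice_tangent_sphere_def by auto
  define A where "A = frechet_derivative (finite_part T) (at (f s))"
  define B where "B = frechet_derivative (finite_part T) (at (f t))"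
  have A: "(finite_part T has_derivative A) (at (f s))" and B: "(finite_part T has_derivative B) (at (f t))"
    unfolding A_def B_def using S pts by (auto intro: conformal_differentiable)
  note lin = has_derivative_linear[OF A] has_derivative_linear[OF B]
  have "pullback (knot_pair f) (pullback (map_prod (finite_part T) (finite_part T)) cross_ratio_form) (s, t) u v =
      cross_ratio_form (finite_part T (f s), finite_part T (f t))
        (fst u *\<^sub>R A a, snd u *\<^sub>R B b) (fst v *\<^sub>R A a, snd v *\<^sub>R B b)"
    unfolding pullback_def knot_pair_def[of f, symmetric] frechet_derivative_at[OF knot_pair_has_derivative[OF f], symmetric]
    by (simp add: knot_pair_def frechet_derivative_at[OF map_prod_has_derivative[OF A B], symmetric] lin linear_scale)
  also have "\<dots> = of_real (ds_dt (s, t) u v) *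
      (plane_coord (A a) * plane_coord (B b) / (plane_coord (finite_part T (f s)) - plane_coord (finite_part T (f t)))\<^sup>2)"
  proof -
    have "plane_coord (k *\<^sub>R c) = of_real k * plane_coord c" for k c
      by (simp add: plane_coord_def complex_eq_iff)
    then show ?thesis by (simp add: cross_ratio_form_def ds_dt_def algebra_simps diff_divide_distrib)
  qed
  finally have "Re (pullback (knot_pair f) (pullback (map_prod (finite_part T) (finite_part T)) cross_ratio_form) (s, t) u v) =
      ds_dt (s, t) u v * Re (plane_coord (A a) * plane_coord (B b) /
        (plane_coord (finite_part T (f s)) - plane_coord (finite_part T (f t)))\<^sup>2)"
    by (simp only: times_complex.sel Re_complex_of_real Im_complex_of_real mult_zero_left diff_0_right)
  also have "Re (plane_coord (A a) * plane_coord (B b) /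
        (plane_coord (finite_part T (f s)) - plane_coord (finite_part T (f t)))\<^sup>2) =
      mixed_log_hessian (finite_part T (f s)) (finite_part T (f t)) (A a) (B b)"
    using S pts nrm unfolding A_def B_def
    by (intro Re_cross_ratio_mixed_log_hessian maps_horizontal_point[OF S(2)] maps_horizontal_tangent[OF S])
  also have "\<dots> = mixed_log_hessian (f s) (f t) a b"
    unfolding A_def B_def by (rule mixed_log_hessian_conformal[OF S(3) pts(3,4)])
  finally show ?thesis .
qed

section \<open>Existence of spheres and transformations\<close>

text \<open>A reflection is orthogonal of determinant \<open>-1\<close>.\<close>
lemma cross3_mirror: 
  assumes "n \<noteq> 0" shows "cross3 (mirror n a) (mirror n b) = - mirror n (cross3 a b)"
proof -
  have id: "(n \<bullet> n) *\<^sub>R cross3 a b =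
      (n \<bullet> cross3 a b) *\<^sub>R n + (n \<bullet> b) *\<^sub>R cross3 a n + (n \<bullet> a) *\<^sub>R cross3 n b"
    by (simp add: cross3_simps forall_3)
  have X: "cross3 a b = (1 / (n \<bullet> n)) *\<^sub>R ((n \<bullet> cross3 a b) *\<^sub>R n + (n \<bullet> b) *\<^sub>R cross3 a n + (n \<bullet> a) *\<^sub>R cross3 n b)"
    using assms by (simp flip: id)
  have "2 *\<^sub>R cross3 a b = (2 * (n \<bullet> cross3 a b) / (n \<bullet> n)) *\<^sub>R n +
      (2 * (n \<bullet> b) / (n \<bullet> n)) *\<^sub>R cross3 a n + (2 * (n \<bullet> a) / (n \<bullet> n)) *\<^sub>R cross3 n b"
    using arg_cong[OF X, of "scaleR 2"] by (simp add: scaleR_add_right)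
  then have "cross3 a b + cross3 a b = (2 * (n \<bullet> cross3 a b) / (n \<bullet> n)) *\<^sub>R n +
      (2 * (n \<bullet> b) / (n \<bullet> n)) *\<^sub>R cross3 a n + (2 * (n \<bullet> a) / (n \<bullet> n)) *\<^sub>R cross3 n b"
    by (simp only: scaleR_2)
  moreover have "cross3 (mirror n a) (mirror n b) = cross3 a b -
      (2 * (n \<bullet> b) / (n \<bullet> n)) *\<^sub>R cross3 a n - (2 * (n \<bullet> a) / (n \<bullet> n)) *\<^sub>R cross3 n b"
    by (simp add: mirror_def Cross3.left_diff_distrib Cross3.right_diff_distrib cross_mult_left cross_mult_right)
  ultimately show ?thesis
    by (simp only: mirror_def[of n "cross3 a b"]) (simp add: algebra_simps)
qed

lemma mirror_mirror: "n \<noteq> 0 \<Longrightarrow> mirror n (mirror n x) = x"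
  by (simp add: mirror_def inner_diff_right)

lemma mirror_minus: "mirror n (- x) = - mirror n x"
  by (simp add: mirror_def)

lemma inner_mirror_normal: "n \<noteq> 0 \<Longrightarrow> mirror n x \<bullet> n = - (x \<bullet> n)"
  by (simp add: mirror_def inner_diff_left inner_commute[of n x])

text \<open>The image plane gets the normal \<open>- mirror m n\<close> and not \<open>mirror m n\<close>, since a reflection
reverses cross products; with this sign positive tangent bases stay positive.\<close>
lemma plane_reflection_Plane:
  assumes "m \<noteq> 0"
  shows "plane_reflection m e ` sphere_points (Plane n d) =
    sphere_points (Plane (- mirror m n) (2 * e * (n \<bullet> m) / (m \<bullet> m) - d))"
proof -
  have sub: "plane_reflection m e ` sphere_points (Plane n d) \<subseteq>
      sphere_points (Plane (- mirror m n) (2 * e * (n \<bullet> m) / (m \<bullet> m) - d))" for n d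
  proof -
    have "- mirror m n \<bullet> (x - (2 * (m \<bullet> x - e) / (m \<bullet> m)) *\<^sub>R m) = 2 * e * (n \<bullet> m) / (m \<bullet> m) - n \<bullet> x" for x
    proof -
      have "x - (2 * (m \<bullet> x - e) / (m \<bullet> m)) *\<^sub>R m = mirror m x + (2 * e / (m \<bullet> m)) *\<^sub>R m"
        by (simp add: mirror_def algebra_simps diff_divide_distrib)
      then show ?thesis by (simp add: inner_add_right inner_mirror[OF assms] inner_mirror_normal[OF assms])
    qed
    then show ?thesis by (auto simp: plane_reflection_def)
  qed
  have inv: "plane_reflection m e (plane_reflection m e p) = p" for p
  proof -
    have some: "plane_reflection m e (plane_reflection m e (Some x)) = Some x" for x
    proof -
      define k where "k = 2 * (m \<bullet> x - e) / (m \<bullet> m)"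
      have k': "2 * (m \<bullet> (x - k *\<^sub>R m) - e) / (m \<bullet> m) = - k"
        using assms by (simp add: k_def inner_diff_right field_simps)
      show ?thesis
        by (simp only: plane_reflection_def option.map k_def[symmetric] k') simp
    qed
    show ?thesis by (cases p) (simp add: plane_reflection_def, simp only: some)
  qed
  \<comment> \<open>As the reflection is an involution, the inclusion for the image plane is the reverse inclusion.\<close>
  define n' d' where "n' = - mirror m n" and "d' = 2 * e * (n \<bullet> m) / (m \<bullet> m) - d"
  have n': "- mirror m n' = n" "n' \<bullet> m = n \<bullet> m"
    using assms by (simp_all add: n'_def mirror_minus mirror_mirror inner_mirror_normal)
  have "sphere_points (Plane n' d') = plane_reflection m e ` plane_reflection m e ` sphere_points (Plane n' d')"
    by (simp add: image_image inv)
  also have "\<dots> \<subseteq> plane_reflection m e ` sphere_points (Plane (- mirror m n') (2 * e * (n' \<bullet> m) / (m \<bullet> m) - d'))"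
    by (intro image_mono sub)
  also have "\<dots> = plane_reflection m e ` sphere_points (Plane n d)"
    unfolding n' by (simp add: d'_def)
  finally show ?thesis using sub[of n d] by (simp only: n'_def d'_def)
qed

lemma maps_oriented_sphere_plane_reflection:
  assumes T: "conformal_transformation T" "maps_oriented_sphere T S (Plane n d)" and m: "m \<noteq> 0"
  shows "maps_oriented_sphere (plane_reflection m e \<circ> T) S (Plane (- mirror m n) (2 * e * (n \<bullet> m) / (m \<bullet> m) - d))"
  unfolding maps_oriented_sphere_def
proof (intro conjI allI impI)
  show "(plane_reflection m e \<circ> T) ` sphere_points S =
      sphere_points (Plane (- mirror m n) (2 * e * (n \<bullet> m) / (m \<bullet> m) - d))"
    using T(2) by (simp only: image_comp[symmetric] maps_oriented_sphere_def plane_reflection_Plane[OF m])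
  fix x a b
  assume x: "Some x \<in> sphere_points S" "(plane_reflection m e \<circ> T) (Some x) \<noteq> None" and ab: "positive_basis_at S x a b"
  let ?g = "\<lambda>y. mirror m y + (2 * e / (m \<bullet> m)) *\<^sub>R m"
  have Tx: "T (Some x) \<noteq> None" using x(2) by (auto simp: plane_reflection_def)
  define A where "A = frechet_derivative (finite_part T) (at x)"
  have A: "(finite_part T has_derivative A) (at x)"
    unfolding A_def by (rule conformal_differentiable[OF T(1) Tx])
  have fin: "finite_part (plane_reflection m e \<circ> T) z = ?g (finite_part T z)" if "T (Some z) \<noteq> None" for z
    using that by (auto simp: finite_part_def plane_reflection_mirror)
  have "(mirror m has_derivative mirror m) (at y)" for y
    by (intro linear_imp_has_derivative linear_mirror)
  then have "((\<lambda>z. ?g (finite_part T z)) has_derivative (\<lambda>h. mirror m (A h))) (at x)"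
    by (rule has_derivative_add_const[OF has_derivative_compose[OF A]])
  then have "(finite_part (plane_reflection m e \<circ> T) has_derivative (\<lambda>h. mirror m (A h))) (at x)"
    by (rule has_derivative_transform_eventually)
      (use conformal_eventually_finite[OF T(1) Tx] fin fin[OF Tx] in \<open>auto elim!: eventually_mono\<close>)
  from frechet_derivative_at[OF this]
  have D: "frechet_derivative (finite_part (plane_reflection m e \<circ> T)) (at x) = (\<lambda>h. mirror m (A h))" by simp
  have "positive_basis_at (Plane n d) (finite_part T x) (A a) (A b)"
    using T(2) x(1) Tx ab unfolding maps_oriented_sphere_def A_def by blast
  then show "positive_basis_at (Plane (- mirror m n) (2 * e * (n \<bullet> m) / (m \<bullet> m) - d))
      (finite_part (plane_reflection m e \<circ> T) x)
      (frechet_derivative (finite_part (plane_reflection m e \<circ> T)) (at x) a)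
      (frechet_derivative (finite_part (plane_reflection m e \<circ> T)) (at x) b)"
    unfolding D by (simp add: positive_basis_at_def inner_mirror[OF m] cross3_mirror[OF m])
qed

lemma maps_oriented_sphere_Plane_scale:
  "k > 0 \<Longrightarrow> maps_oriented_sphere T S (Plane (k *\<^sub>R n) (k * d)) \<longleftrightarrow> maps_oriented_sphere T S (Plane n d)"
  by (simp add: maps_oriented_sphere_def positive_basis_at_def zero_less_mult_iff)

lemma maps_oriented_sphere_id: "maps_oriented_sphere id S S"
proof -
  have "finite_part id = id" by (auto simp: finite_part_def)
  then show ?thesis by (simp add: maps_oriented_sphere_def)
qed

lemma inversion_has_derivative:
  assumes "z \<noteq> c"
  shows "(finite_part (inversion c 1) has_derivative
    (\<lambda>h. (1 / ((z - c) \<bullet> (z - c))) *\<^sub>R mirror (z - c) h)) (at z)"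
proof -
  define w where "w = z - c"
  have w: "w \<bullet> w \<noteq> 0" using assms by (simp add: w_def)
  have d: "((\<lambda>x. x - c) has_derivative (\<lambda>h. h)) (at z)"
    by (auto intro!: derivative_eq_intros)
  have "((\<lambda>x. (x - c) \<bullet> (x - c)) has_derivative (\<lambda>h. 2 * (w \<bullet> h))) (at z)"
    using has_derivative_inner[OF d d] by (simp add: w_def inner_commute)
  from has_derivative_divide[OF has_derivative_const[of 1] this] w
  have "((\<lambda>x. 1 / ((x - c) \<bullet> (x - c))) has_derivative (\<lambda>h. - (2 * (w \<bullet> h) / (w \<bullet> w)\<^sup>2))) (at z)"
    by (simp add: w_def power2_eq_square divide_inverse mult_ac)
  from has_derivative_add_const[OF has_derivative_scaleR[OF this d], of c]
  have "((\<lambda>x. c + (1 / ((x - c) \<bullet> (x - c))) *\<^sub>R (x - c)) has_derivative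
      (\<lambda>h. (1 / (w \<bullet> w)) *\<^sub>R mirror w h)) (at z)"
    by (simp add: w_def mirror_def add.commute algebra_simps power2_eq_square)
  then show ?thesis
    unfolding w_def
    by (rule has_derivative_transform_within_open[of _ _ _ _ "- {c}"])
      (use assms in \<open>auto simp: finite_part_def inversion_def power2_norm_eq_inner\<close>)
qed

lemma inversion_involutive: "inversion c 1 (inversion c 1 p) = p"
proof (cases "p = None \<or> p = Some c")
  case False
  then obtain x where x: "p = Some x" "x \<noteq> c" by (cases p) auto
  define w where "w = x - c"
  have w: "w \<bullet> w \<noteq> 0" using x by (simp add: w_def)
  have "inversion c 1 p = Some (c + (1 / (w \<bullet> w)) *\<^sub>R w)"
    using x by (simp add: inversion_def power2_norm_eq_inner w_def)
  moreover have "(norm ((1 / (w \<bullet> w)) *\<^sub>R w))\<^sup>2 = 1 / (w \<bullet> w)"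
    unfolding power2_norm_eq_inner using w by simp
  ultimately have "inversion c 1 (inversion c 1 p) = Some (c + w)"
    using w by (simp add: inversion_def)
  then show ?thesis by (simp add: w_def x)
qed (auto simp: inversion_def)

text \<open>A sphere through the centre \<open>c\<close> of the inversion goes to a plane parallel to its tangent plane
at \<open>c\<close>. Multiplying by \<open>2 \<rho>\<close> turns both equations into statements about
\<open>n \<bullet> (z - c)\<close>.\<close>
lemma inversion_Round:
  assumes "\<rho> \<noteq> 0" "norm (c - c0) = \<bar>\<rho>\<bar>"
  defines "n \<equiv> (1 / \<rho>) *\<^sub>R (c0 - c)"
  shows "inversion c 1 ` sphere_points (Round c0 \<rho>) = sphere_points (Plane n (n \<bullet> c + 1 / (2 * \<rho>)))"
proof -
  have cc: "(c - c0) \<bullet> (c - c0) = \<rho>\<^sup>2"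
    using assms(2) by (metis power2_abs power2_norm_eq_inner)
  have sph: "dist c0 z = \<bar>\<rho>\<bar> \<longleftrightarrow> (z - c) \<bullet> (z - c) = 2 * \<rho> * (n \<bullet> (z - c))" for z
  proof -
    have "dist c0 z = \<bar>\<rho>\<bar> \<longleftrightarrow> (z - c0) \<bullet> (z - c0) = \<rho>\<^sup>2"
      by (simp add: dist_norm norm_minus_commute[of c0] norm_eq_square del: norm_eq_zero)
    also have "(z - c0) \<bullet> (z - c0) = (z - c) \<bullet> (z - c) - 2 * \<rho> * (n \<bullet> (z - c)) + (c - c0) \<bullet> (c - c0)"
      using assms(1) by (simp add: n_def inner_diff_left inner_diff_right inner_commute algebra_simps)
    finally show ?thesis using cc by simp
  qed
  have pl: "n \<bullet> y = n \<bullet> c + 1 / (2 * \<rho>) \<longleftrightarrow> 2 * \<rho> * (n \<bullet> (y - c)) = 1" for y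
    using assms(1) by (simp add: inner_diff_right field_simps)
  have "(inversion c 1 p \<in> sphere_points (Plane n (n \<bullet> c + 1 / (2 * \<rho>)))) = (p \<in> sphere_points (Round c0 \<rho>))" for p
  proof (cases "p = None \<or> p = Some c")
    case True
    then show ?thesis
      using assms(1,2) by (auto simp: inversion_def dist_norm norm_minus_commute)
  next
    case False
    then obtain z where z: "p = Some z" "z \<noteq> c" by (cases p) auto
    then have "(z - c) \<bullet> (z - c) \<noteq> 0" by simp
    have "inversion c 1 p = Some (c + (1 / ((z - c) \<bullet> (z - c))) *\<^sub>R (z - c))"
      using z by (simp add: inversion_def power2_norm_eq_inner)
    then have "(inversion c 1 p \<in> sphere_points (Plane n (n \<bullet> c + 1 / (2 * \<rho>)))) \<longleftrightarrow>
        2 * \<rho> * (n \<bullet> (z - c)) / ((z - c) \<bullet> (z - c)) = 1"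
      using pl[of "c + (1 / ((z - c) \<bullet> (z - c))) *\<^sub>R (z - c)"] by auto
    also have "\<dots> \<longleftrightarrow> dist c0 z = \<bar>\<rho>\<bar>"
      using \<open>(z - c) \<bullet> (z - c) \<noteq> 0\<close> by (auto simp: sph)
    finally show ?thesis using z by auto
  qed
  note iff = this
  show ?thesis
  proof (intro equalityI subsetI)
    fix p assume "p \<in> sphere_points (Plane n (n \<bullet> c + 1 / (2 * \<rho>)))"
    then have "inversion c 1 p \<in> sphere_points (Round c0 \<rho>)"
      using iff[of "inversion c 1 p"] by (simp only: inversion_involutive)
    then show "p \<in> inversion c 1 ` sphere_points (Round c0 \<rho>)"
      by (rule rev_image_eqI) (simp only: inversion_involutive)
  next
    fix p assume "p \<in> inversion c 1 ` sphere_points (Round c0 \<rho>)"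
    then obtain p' where "p = inversion c 1 p'" "p' \<in> sphere_points (Round c0 \<rho>)" by (rule imageE)
    then show "p \<in> sphere_points (Plane n (n \<bullet> c + 1 / (2 * \<rho>)))" by (simp only: iff)
  qed
qed

text \<open>The derivative of the inversion is a positive multiple of the reflection \<open>mirror (z - c)\<close>, which
exchanges the unit normals of the sphere at the ends of the chord from \<open>c\<close> to \<open>z\<close>. As for
plane reflections, the normal of the image is the negative of the reflected normal.\<close>
lemma maps_oriented_sphere_inversion:
  assumes "\<rho> \<noteq> 0" "norm (c - c0) = \<bar>\<rho>\<bar>"
  defines "n \<equiv> (1 / \<rho>) *\<^sub>R (c0 - c)"
  shows "maps_oriented_sphere (inversion c 1) (Round c0 \<rho>) (Plane n (n \<bullet> c + 1 / (2 * \<rho>)))"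
  unfolding maps_oriented_sphere_def
proof (intro conjI allI impI)
  show "inversion c 1 ` sphere_points (Round c0 \<rho>) = sphere_points (Plane n (n \<bullet> c + 1 / (2 * \<rho>)))"
    unfolding n_def using assms(1,2) by (rule inversion_Round)
  fix z a b
  assume z: "Some z \<in> sphere_points (Round c0 \<rho>)" "inversion c 1 (Some z) \<noteq> None"
    and ab: "positive_basis_at (Round c0 \<rho>) z a b"
  define w where "w = z - c"
  have zc: "z \<noteq> c" using z(2) by (auto simp: inversion_def)
  then have w: "w \<noteq> 0" "w \<bullet> w > 0" by (simp_all add: w_def)
  define N where "N = (1 / \<rho>) *\<^sub>R (z - c0)"
  have n: "n = - mirror w N"
  proof -
    have "(c - c0) \<bullet> (c - c0) = (z - c0) \<bullet> (z - c0)"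
      using z(1) assms(2) by (auto simp: dist_norm norm_minus_commute simp flip: norm_eq)
    then have "w \<bullet> w = 2 * (w \<bullet> (z - c0))"
      by (simp add: w_def inner_diff_left inner_diff_right inner_commute)
    then have "2 * (w \<bullet> N) / (w \<bullet> w) = 1 / \<rho>"
      using w(2) by (simp add: N_def)
    then show ?thesis by (simp add: mirror_def n_def N_def w_def algebra_simps)
  qed
  have D: "frechet_derivative (finite_part (inversion c 1)) (at z) = (\<lambda>h. (1 / (w \<bullet> w)) *\<^sub>R mirror w h)"
    using frechet_derivative_at[OF inversion_has_derivative[OF zc]] by (simp add: w_def)
  show "positive_basis_at (Plane n (n \<bullet> c + 1 / (2 * \<rho>))) (finite_part (inversion c 1) z)
      (frechet_derivative (finite_part (inversion c 1)) (at z) a)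
      (frechet_derivative (finite_part (inversion c 1)) (at z) b)"
    using ab w unfolding D
    by (simp add: positive_basis_at_def n N_def[symmetric] cross_mult_left cross_mult_right
        cross3_mirror[OF w(1)] inner_mirror[OF w(1)])
qed

lemma sphere_has_third_point:
  fixes c0 p q :: "real ^ 3"
  assumes "\<rho> > 0" obtains c where "norm (c - c0) = \<rho>" "c \<noteq> p" "c \<noteq> q"
proof -
  define e where "e i = c0 + \<rho> *\<^sub>R axis i 1" for i :: 3
  have "e 1 \<noteq> e 2" "e 1 \<noteq> e 3" "e 2 \<noteq> e 3"
    using assms by (simp_all add: e_def axis_eq_axis)
  then have "(e 1 \<noteq> p \<and> e 1 \<noteq> q) \<or> (e 2 \<noteq> p \<and> e 2 \<noteq> q) \<or> (e 3 \<noteq> p \<and> e 3 \<noteq> q)"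
    by auto
  then obtain i where "e i \<noteq> p" "e i \<noteq> q" by blast
  moreover have "norm (e i - c0) = \<rho>" using assms by (simp add: e_def norm_axis_1)
  ultimately show thesis using that by blast
qed

text \<open>A round sphere is inverted at one of its points that differs from \<open>p\<close> and \<open>q\<close>, so that these stay
finite.\<close>
lemma conformal_to_plane:
  assumes "valid_sphere S"
  obtains T n d where "conformal_transformation T" "T (Some p) \<noteq> None" "T (Some q) \<noteq> None"
    "norm n = 1" "maps_oriented_sphere T S (Plane n d)"
proof (cases S)
  case (Round c0 \<rho>)
  obtain c where c: "norm (c - c0) = \<bar>\<rho>\<bar>" "c \<noteq> p" "c \<noteq> q"
    using sphere_has_third_point[of "\<bar>\<rho>\<bar>" c0 p q] assms Round by auto
  define n where "n = (1 / \<rho>) *\<^sub>R (c0 - c)"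
  have "conformal_transformation (inversion c 1)"
    using conformal_transformation.inversion[OF conformal_transformation.identity, of 1 c] by simp
  moreover have "norm n = 1" using c(1) assms Round by (simp add: n_def norm_minus_commute)
  moreover have "maps_oriented_sphere (inversion c 1) S (Plane n (n \<bullet> c + 1 / (2 * \<rho>)))"
    unfolding Round n_def using assms Round c(1) by (intro maps_oriented_sphere_inversion) auto
  ultimately show thesis using c(2,3) by (intro that) (auto simp: inversion_def)
next
  case (Plane m e)
  then have m: "norm m > 0" using assms by simp
  then have "maps_oriented_sphere id S (Plane (m /\<^sub>R norm m) (e / norm m))"
    using maps_oriented_sphere_id[of S] maps_oriented_sphere_Plane_scale[of "norm m" id S "m /\<^sub>R norm m" "e / norm m"]
    by (simp add: Plane)
  with m show thesis
    by (intro that[OF conformal_transformation.identity]) auto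
qed

text \<open>Once the sphere is a plane, one reflection makes its oriented normal vertical, and a second one
in a horizontal mirror moves it to height zero; the latter keeps the normal, because it
reverses both the vertical direction and the cross product.\<close>
lemma cross_ratio_transformation_exists_for:
  assumes S: "twice_tangent_sphere f s t S"
  obtains T where "cross_ratio_transformation f s t S T"
proof -
  have "valid_sphere S" using S by (simp add: twice_tangent_sphere_def)
  then obtain T n d where T: "conformal_transformation T" "maps_oriented_sphere T S (Plane n d)"
    and fin: "T (Some (f s)) \<noteq> None" "T (Some (f t)) \<noteq> None" and n: "norm n = 1"
    using conformal_to_plane[of S "f s" "f t"] by metis
  define e3 :: "real ^ 3" where "e3 = axis 3 1"
  have e3: "e3 \<bullet> e3 = 1" "norm e3 = 1" by (simp_all add: e3_def inner_axis_axis norm_axis_1)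
  have nn: "n \<bullet> n = 1" using n by (simp add: norm_eq_1)
  \<comment> \<open>The mirror must send \<open>n\<close> to \<open>- e3\<close>. Its normal \<open>n + e3\<close> vanishes if \<open>n = - e3\<close>; then any
vertical mirror fixes \<open>n\<close>.\<close>
  obtain m where m: "m \<noteq> 0" "- mirror m n = e3"
  proof (cases "n + e3 = 0")
    case True
    then have "n = - e3" by (simp add: eq_neg_iff_add_eq_0)
    then have "- mirror (axis 1 1) n = e3"
      by (simp add: mirror_def e3_def inner_axis_axis)
    then show thesis by (intro that[of "axis 1 1"]) (simp_all add: axis_eq_0_iff)
  next
    case False
    have "(n + e3) \<bullet> (n + e3) = 2 * ((n + e3) \<bullet> n)"
      by (simp add: inner_add_left inner_add_right inner_commute nn e3)
    moreover have "(n + e3) \<bullet> (n + e3) \<noteq> 0" using False by simp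
    ultimately have "mirror (n + e3) n = n - 1 *\<^sub>R (n + e3)"
      unfolding mirror_def by simp
    then show thesis using False by (intro that[of "n + e3"]) simp_all
  qed
  define T1 where "T1 = plane_reflection m 0 \<circ> T"
  define T2 where "T2 = plane_reflection e3 (- d / 2) \<circ> T1"
  have conf: "conformal_transformation T1" "conformal_transformation T2"
    unfolding T2_def T1_def using T m e3 by (auto intro!: conformal_transformation.reflection)
  have T1: "maps_oriented_sphere T1 S (Plane e3 (- d))"
    using maps_oriented_sphere_plane_reflection[OF T m(1), of 0] by (simp add: T1_def m)
  have "maps_oriented_sphere T2 S (Plane (- mirror e3 e3) (2 * (- d / 2) * (e3 \<bullet> e3) / (e3 \<bullet> e3) - (- d)))"
    unfolding T2_def by (rule maps_oriented_sphere_plane_reflection[OF conf(1) T1]) (use e3 in auto)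
  then have "maps_oriented_sphere T2 S horizontal_plane"
    by (simp add: e3 mirror_def horizontal_plane_def e3_def[symmetric] scaleR_2)
  moreover have "T2 (Some (f s)) \<noteq> None" "T2 (Some (f t)) \<noteq> None"
    using fin by (simp_all add: T2_def T1_def plane_reflection_def)
  ultimately show thesis
    using conf S by (intro that) (simp add: cross_ratio_transformation_def)
qed

text \<open>Let \<open>d\<close> be the chord. A sphere through both ends with centre \<open>f s + h\<close> has
\<open>2 (h \<bullet> d) = d \<bullet> d\<close>, and given this, tangency says that \<open>h\<close> is orthogonal to the tangent \<open>a\<close> at
one end and to the mirror image of the tangent \<open>b\<close> at the other. Two such conditions leave a
direction \<open>n\<close> in space, and \<open>h\<close> is the right multiple of it; if \<open>n\<close> is orthogonal to \<open>d\<close> the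
sphere degenerates to a plane.\<close>
lemma twice_tangent_sphere_exists:
  assumes "f s \<noteq> f t" obtains S where "twice_tangent_sphere f s t S"
proof -
  define x d a b where "x = f s" and "d = f t - f s"
    and "a = vector_derivative f (at s)" and "b = vector_derivative f (at t)"
  have d: "d \<bullet> d \<noteq> 0" using assms by (simp add: d_def)
  have ft: "f t = x + d" by (simp add: x_def d_def)
  have "dim {a, mirror d b} < DIM(real ^ 3)"
    using dim_le_card'[of "{a, mirror d b}"] card_insert_le_m1[of 2 "{mirror d b}" a] by simp
  then obtain n where n: "n \<noteq> 0" "n \<bullet> a = 0" "n \<bullet> mirror d b = 0"
    using orthogonal_to_subspace_exists[of "{a, mirror d b}"]
    by (metis insertCI orthogonal_def span_base)
  have nb: "n \<bullet> b = 2 * (d \<bullet> b) / (d \<bullet> d) * (n \<bullet> d)"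
    using n(3) by (simp add: mirror_def inner_diff_right)
  show thesis
  proof (cases "n \<bullet> d = 0")
    case True
    then have "twice_tangent_sphere f s t (Plane n (n \<bullet> x))"
      using n nb by (auto simp: twice_tangent_sphere_def x_def[symmetric] ft a_def[symmetric] b_def[symmetric] inner_add_right)
    then show thesis by (rule that)
  next
    case False
    define h where "h = (d \<bullet> d / (2 * (n \<bullet> d))) *\<^sub>R n"
    have h: "h \<noteq> 0" "h \<bullet> a = 0" "h \<bullet> b = d \<bullet> b" "2 * (h \<bullet> d) = d \<bullet> d"
      using n nb d False by (simp_all add: h_def)
    have "norm (d - h) = norm h"
      unfolding norm_eq using h(4) by (simp add: inner_diff_left inner_diff_right inner_commute)
    then have "twice_tangent_sphere f s t (Round (x + h) (norm h))"
      using h by (auto simp: twice_tangent_sphere_def x_def[symmetric] ft a_def[symmetric] b_def[symmetric]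
          dist_norm inner_diff_left inner_add_left norm_minus_commute)
    then show thesis by (rule that)
  qed
qed

section \<open>The three forms agree\<close>

theorem lemma4p3p7:
  fixes f :: "real \<Rightarrow> real ^ 3" and L s t :: real and u v :: "real \<times> real"
  assumes "knot L f" and "f s \<noteq> f t"
  shows "cos (conformal_angle f s t) * (ds_dt (s, t) u v / (norm (f s - f t))\<^sup>2)
           = Re (Omega_CR f (s, t) u v) \<and>
         Re (Omega_CR f (s, t) u v)
           = - (1 / 2) * pullback (knot_pair f) omega_R (s, t) u v \<and>
         - (1 / 2) * pullback (knot_pair f) omega_R (s, t) u v
           = - (1 / 2) * pullback (knot_pair f)
               (pullback stereographic_pair (pullback psi omega_0)) (s, t) u v"
proof -
  define a b where "a = vector_derivative f (at s)" and "b = vector_derivative f (at t)"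
  have unit: "norm a = 1" "norm b = 1"
    using assms(1) by (simp_all add: knot_def a_def b_def)
  have "f differentiable (at r)" for r
    using assms(1) by (auto simp: knot_def C2_on_def differentiable_def)
  then have f: "(f has_vector_derivative a) (at s)" "(f has_vector_derivative b) (at t)"
    unfolding a_def b_def using vector_derivative_works by blast+
  define Q where "Q = mixed_log_hessian (f s) (f t) a b"
  have "cos (conformal_angle f s t) = (norm (f s - f t))\<^sup>2 * Q"
    using cos_conformal_angle[OF assms(2)] unit by (simp add: Q_def a_def b_def)
  then have angle: "cos (conformal_angle f s t) * (ds_dt (s, t) u v / (norm (f s - f t))\<^sup>2) = ds_dt (s, t) u v * Q"
    using assms(2) by simp
  have CR: "Re (Omega_CR f (s, t) u v) = ds_dt (s, t) u v * Q"
  proof -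
    define ST where "ST = (SOME (S, T). cross_ratio_transformation f s t S T)"
    obtain S0 where "twice_tangent_sphere f s t S0"
      by (rule twice_tangent_sphere_exists[OF assms(2)])
    then obtain T0 where "cross_ratio_transformation f s t S0 T0"
      by (rule cross_ratio_transformation_exists_for)
    then have "case (S0, T0) of (S, T) \<Rightarrow> cross_ratio_transformation f s t S T" by simp
    then have "case ST of (S, T) \<Rightarrow> cross_ratio_transformation f s t S T"
      unfolding ST_def by (rule someI)
    then obtain S T where ST: "ST = (S, T)" "cross_ratio_transformation f s t S T"
      by (cases ST) auto
    show ?thesis
      using Re_pullback_cross_ratio_form[OF f ST(2)] ST(1)
      by (simp add: Omega_CR_def ST_def[symmetric] Q_def)
  qed
  have "pullback (knot_pair f) omega_R (s, t) u v =
      omega_R (f s, f t) (fst u *\<^sub>R a, snd u *\<^sub>R b) (fst v *\<^sub>R a, snd v *\<^sub>R b)"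
    unfolding pullback_def frechet_derivative_at[OF knot_pair_has_derivative[OF f], symmetric]
    by (simp add: knot_pair_def)
  also have "\<dots> = - 2 * (ds_dt (s, t) u v * Q)"
    unfolding omega_R_eq[OF assms(2)] Q_def
    by (simp add: mixed_log_hessian_scaleR ds_dt_def algebra_simps)
  finally have omega: "- (1 / 2) * pullback (knot_pair f) omega_R (s, t) u v = ds_dt (s, t) u v * Q"
    by simp
  show ?thesis
    unfolding angle CR omega omega_R_def[symmetric] by simp
qed

end
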